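(* Let $\mathbf v\in\Sigma$ be a vector in a periodic direction on the golden L. Then there is a unique finite sequence of sectors $(k_0,k_1,\dots,k_n)$, namely the sector itinerary of $\mathbf v$ (truncated when it becomes constantly $0$), such that $$\mathbf v=\ell_{\mathbf v}\,\sigma_{k_0}\sigma_{k_1}\cdots\sigma_{k_n}\begin{bmatrix}1\\0\end{bmatrix}$$ for some length $\ell_{\mathbf v}>0$. The long saddle connection vector in the direction of $\mathbf v$ is $\sigma_{k_0}\cdots\sigma_{k_n}\begin{bmatrix}1\\0\end{bmatrix}$. Furthermore, this long saddle connection vector is of the form $\begin{bmatrix}a+b\phi\\c+d\phi\end{bmatrix}$ with $a,b,c,d\in\mathbb{N}$ (nonnegative integers).
   Context: Let $\phi=(1+\sqrt5)/2$. The golden L is the translation surface obtained from the polygon $([0,\phi]\times[0,1])\cup([0,1]\times[0,\phi])$ by gluing by translation the sides $\{\phi\}\times[0,1]$ to $\{0\}\times[0,1]$, $\{1\}\times[1,\phi]$ to $\{0\}\times[1,\phi]$, $[1,\phi]\times\{1\}$ to $[1,\phi]\times\{0\}$, and $[0,1]\times\{\phi\}$ to $[0,1]\times\{0\}$. It has a single singularity, of cone angle $6\pi$. A saddle connection is a straight segment with both endpoints at the singularity and no singularity in its interior. A periodic direction is the direction of a periodic trajectory; in each periodic direction the saddle connections have exactly two lengths (short and long), with ratio $\phi$. $\Sigma=\{(x,y)\in\mathbb{R}^2: x>0,\ y\ge 0\}$ and $\sigma_0=\begin{bmatrix}1&\phi\\0&1\end{bmatrix}$, $\sigma_1=\begin{bmatrix}\phi&\phi\\1&\phi\end{bmatrix}$,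 $\sigma_2=\begin{bmatrix}\phi&1\\\phi&\phi\end{bmatrix}$, $\sigma_3=\begin{bmatrix}1&0\\\phi&1\end{bmatrix}$. The sectors $\Sigma_i=\sigma_i\Sigma$, $i=0,1,2,3$, partition $\Sigma$: $\Sigma_0=\{0\le y<x/\phi\}$, $\Sigma_1=\{x/\phi\le y<x\}$, $\Sigma_2=\{x\le y<\phi x\}$, $\Sigma_3=\{\phi x\le y\}$ (all intersected with $\Sigma$). Sector itinerary of $\mathbf v\in\Sigma$: put $\mathbf v_0=\mathbf v$, and for $i\ge0$ let $k_i$ be the index with $\mathbf v_i\in\Sigma_{k_i}$ and $\mathbf v_{i+1}=\sigma_{k_i}^{-1}\mathbf v_i$. For $\mathbf v$ in a periodic direction the sequence $(k_i)$ is eventually constantly $0$; the truncated itinerary is obtained by deleting the terminal string of $0$'s, so its last entry is nonzero (it is empty if $\mathbf v$ is horizontal, and the product of matrices is then the identity). Uniqueness is among finite sequences that are empty or have nonzero last entry. *)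

theory Defs
  imports "HOL-Analysis.Analysis"
begin

definition phi :: real where
  "phi = (1 + sqrt 5) / 2"

section \<open>The golden L\<close>

abbreviation pt :: "real \<Rightarrow> real \<Rightarrow> real^2" where
  "pt x y \<equiv> vector [x, y]"

definition L_polygon :: "(real^2) set" where
  "L_polygon = {pt x y | x y. 0 \<le> x \<and> x \<le> phi \<and> 0 \<le> y \<and> y \<le> 1}
             \<union> {pt x y | x y. 0 \<le> x \<and> x \<le> 1 \<and> 0 \<le> y \<and> y \<le> phi}"

definition side_gluing :: "((real^2) \<times> (real^2)) set" where
  "side_gluing =
      {(pt phi y, pt 0 y) | y. 0 \<le> y \<and> y \<le> 1}
    \<union> {(pt 1 y, pt 0 y) | y. 1 \<le> y \<and> y \<le> phi}
    \<union> {(pt x 1, pt x 0) | x. 1 \<le> x \<and> x \<le> phi}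
    \<union> {(pt x phi, pt x 0) | x. 0 \<le> x \<and> x \<le> 1}"

definition L_equiv :: "((real^2) \<times> (real^2)) set" where
  "L_equiv = {(p, q). p \<in> L_polygon \<and> q \<in> L_polygon \<and> (p, q) \<in> (side_gluing \<union> side_gluing\<inverse>)\<^sup>*}"

definition golden_L :: "(real^2) set set" where
  "golden_L = L_polygon // L_equiv"

text \<open>The endpoints of the eight sides that are glued in pairs.\<close>

definition L_vertices :: "(real^2) set" where
  "L_vertices = {pt 0 0, pt 1 0, pt phi 0, pt phi 1, pt 1 1, pt 1 phi, pt 0 phi, pt 0 1}"

definition singular :: "(real^2) set \<Rightarrow> bool" where
  "singular X \<longleftrightarrow> X \<in> golden_L \<and> X \<inter> L_vertices \<noteq> {}"

section \<open>Straight-line paths, periodic directions and saddle connections\<close>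

text \<open>A path on the surface, parametrised by an interval \<open>I\<close>, moves with constant velocity \<open>w\<close> if
  near each parameter \<open>t\<close> it is read off in the polygon as a segment \<open>p + s w\<close> that starts (for the
  future) or ends (for the past) at some representative \<open>p\<close> of its position at \<open>t\<close>. The two
  representatives differ when the path crosses a side of the polygon. At a nonsingular point all
  admissible choices of the representative give the same germ of path, since sides are glued by
  translations.\<close>

definition straight_path :: "real set \<Rightarrow> real^2 \<Rightarrow> (real \<Rightarrow> (real^2) set) \<Rightarrow> bool" where
  "straight_path I w \<gamma> \<longleftrightarrow>
     (\<forall>t\<in>I. \<gamma> t \<in> golden_L) \<and>
     (\<forall>t\<in>I. \<exists>e>0. \<exists>p\<in>\<gamma> t. \<forall>s\<in>{0..e}. t + s \<in> I \<longrightarrow> p + s *\<^sub>R w \<in> \<gamma> (t + s)) \<and>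
     (\<forall>t\<in>I. \<exists>e>0. \<exists>p\<in>\<gamma> t. \<forall>s\<in>{0..e}. t - s \<in> I \<longrightarrow> p - s *\<^sub>R w \<in> \<gamma> (t - s))"

definition periodic_trajectory :: "real^2 \<Rightarrow> (real \<Rightarrow> (real^2) set) \<Rightarrow> bool" where
  "periodic_trajectory w \<gamma> \<longleftrightarrow>
     w \<noteq> 0 \<and> straight_path UNIV w \<gamma> \<and> (\<forall>t. \<not> singular (\<gamma> t)) \<and>
     (\<exists>T>0. \<forall>t. \<gamma> (t + T) = \<gamma> t)"

definition same_direction :: "real^2 \<Rightarrow> real^2 \<Rightarrow> bool" where
  "same_direction v w \<longleftrightarrow> v \<noteq> 0 \<and> (\<exists>c>0. w = c *\<^sub>R v)"

definition periodic_direction :: "real^2 \<Rightarrow> bool" where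
  "periodic_direction v \<longleftrightarrow> (\<exists>w \<gamma>. same_direction v w \<and> periodic_trajectory w \<gamma>)"

text \<open>\<open>w\<close> is the holonomy vector of a saddle connection, traversed in unit time.\<close>

definition saddle_connection_vector :: "real^2 \<Rightarrow> bool" where
  "saddle_connection_vector w \<longleftrightarrow>
     w \<noteq> 0 \<and>
     (\<exists>\<gamma>. straight_path {0..1} w \<gamma> \<and> singular (\<gamma> 0) \<and> singular (\<gamma> 1) \<and>
          (\<forall>t\<in>{0<..<1}. \<not> singular (\<gamma> t)))"

definition saddle_lengths :: "real^2 \<Rightarrow> real set" where
  "saddle_lengths v = {norm w | w. saddle_connection_vector w \<and> same_direction v w}"

text \<open>The saddle connections in the direction of \<open>v\<close> have exactly two lengths, and \<open>w\<close> has the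
  larger one.\<close>

definition long_saddle_connection_vector :: "real^2 \<Rightarrow> real^2 \<Rightarrow> bool" where
  "long_saddle_connection_vector v w \<longleftrightarrow>
     saddle_connection_vector w \<and> same_direction v w \<and>
     (\<exists>short. short < norm w \<and> saddle_lengths v = {short, norm w})"

section \<open>Sectors and itineraries\<close>

definition Sigma_sector :: "(real^2) set" where
  "Sigma_sector = {v. v $ 1 > 0 \<and> v $ 2 \<ge> 0}"

text \<open>Only the indices \<open>0, 1, 2, 3\<close> are meaningful.\<close>

definition sigma :: "nat \<Rightarrow> real^2^2" where
  "sigma k =
     [vector [vector [1, phi], vector [0, 1]],
      vector [vector [phi, phi], vector [1, phi]],
      vector [vector [phi, 1], vector [phi, phi]],
      vector [vector [1, 0], vector [phi, 1]]] ! k"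

definition sector :: "nat \<Rightarrow> (real^2) set" where
  "sector k = (\<lambda>v. sigma k *v v) ` Sigma_sector"

definition sector_index :: "real^2 \<Rightarrow> nat" where
  "sector_index v = (THE k. k < 4 \<and> v \<in> sector k)"

primrec sector_orbit :: "real^2 \<Rightarrow> nat \<Rightarrow> real^2" where
  "sector_orbit v 0 = v"
| "sector_orbit v (Suc i) =
     matrix_inv (sigma (sector_index (sector_orbit v i))) *v sector_orbit v i"

definition sector_itinerary :: "real^2 \<Rightarrow> nat \<Rightarrow> nat" where
  "sector_itinerary v i = sector_index (sector_orbit v i)"

text \<open>The finite sequences among which uniqueness is claimed.\<close>

definition admissible_seq :: "nat list \<Rightarrow> bool" where
  "admissible_seq ks \<longleftrightarrow> set ks \<subseteq> {..<4} \<and> (ks = [] \<or> last ks \<noteq> 0)"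

text \<open>In particular the itinerary is eventually constantly \<open>0\<close>.\<close>

definition truncated_itinerary :: "real^2 \<Rightarrow> nat list \<Rightarrow> bool" where
  "truncated_itinerary v ks \<longleftrightarrow>
     (ks = [] \<or> last ks \<noteq> 0) \<and>
     (\<forall>i. sector_itinerary v i = (if i < length ks then ks ! i else 0))"

definition sigma_prod :: "nat list \<Rightarrow> real^2^2" where
  "sigma_prod ks = foldr (\<lambda>k M. sigma k ** M) ks (mat 1)"

section \<open>Well-definedness of the surface and of the itinerary\<close>

lemma phi_bounds: "1 < phi" "phi < 2"
proof -
  have "sqrt 5 > 1" by simp
  moreover have "sqrt 5 < 3" by (rule real_less_lsqrt) auto
  ultimately show "1 < phi" "phi < 2" by (auto simp: phi_def)
qed

lemma phi_square: "phi * phi = phi + 1"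
proof -
  have "sqrt 5 * sqrt 5 = (5::real)" by simp
  then show ?thesis by (simp add: phi_def field_simps)
qed

lemma pt_eq_iff: "pt a b = pt c d \<longleftrightarrow> a = c \<and> b = d"
  by (auto simp: vec_eq_iff forall_2)

lemma equiv_L_equiv: "equiv L_polygon L_equiv"
proof (rule equivI)
  show "L_equiv \<subseteq> L_polygon \<times> L_polygon" by (auto simp: L_equiv_def)
  show "refl_on L_polygon L_equiv" by (auto simp: refl_on_def L_equiv_def)
  have "sym ((side_gluing \<union> side_gluing\<inverse>)\<^sup>*)" by (rule sym_rtrancl) (auto simp: sym_def)
  then show "sym L_equiv" by (auto simp: L_equiv_def sym_def)
  show "trans L_equiv" by (auto simp: L_equiv_def trans_def)
qed

lemma L_vertices_subset: "L_vertices \<subseteq> L_polygon"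
  using phi_bounds by (auto simp: L_vertices_def L_polygon_def pt_eq_iff)

lemma L_vertices_equiv:
  assumes "p \<in> L_vertices" "q \<in> L_vertices"
  shows "(p, q) \<in> L_equiv"
proof -
  let ?R = "side_gluing \<union> side_gluing\<inverse>"
  have g: "(pt phi 0, pt 0 0) \<in> ?R" "(pt phi 1, pt 0 1) \<in> ?R" "(pt 1 1, pt 0 1) \<in> ?R"
    "(pt 1 phi, pt 0 phi) \<in> ?R" "(pt 1 1, pt 1 0) \<in> ?R" "(pt phi 1, pt phi 0) \<in> ?R"
    "(pt 0 phi, pt 0 0) \<in> ?R" "(pt 1 phi, pt 1 0) \<in> ?R"
    using phi_bounds by (auto simp: side_gluing_def pt_eq_iff)
  have s: "sym (?R\<^sup>*)" by (rule sym_rtrancl) (auto simp: sym_def)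
  have c: "(a, b) \<in> ?R\<^sup>*" if "(a, b) \<in> ?R" for a b using that by (rule r_into_rtrancl)
  have "(r, pt 0 0) \<in> ?R\<^sup>*" if "r \<in> L_vertices" for r
  proof -
    have 1: "(pt phi 0, pt 0 0) \<in> ?R\<^sup>*" using c g by blast
    have 2: "(pt phi 1, pt 0 0) \<in> ?R\<^sup>*" using 1 c g by (meson rtrancl_trans)
    have 3: "(pt 0 1, pt 0 0) \<in> ?R\<^sup>*" using 2 c g s by (meson rtrancl_trans symD)
    have 4: "(pt 1 1, pt 0 0) \<in> ?R\<^sup>*" using 3 c g by (meson rtrancl_trans)
    have 5: "(pt 1 0, pt 0 0) \<in> ?R\<^sup>*" using 4 c g s by (meson rtrancl_trans symD)
    have 6: "(pt 1 phi, pt 0 0) \<in> ?R\<^sup>*" using 5 c g by (meson rtrancl_trans)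
    have 7: "(pt 0 phi, pt 0 0) \<in> ?R\<^sup>*" using c g by blast
    show ?thesis using that 1 2 3 4 5 6 7 unfolding L_vertices_def by blast
  qed
  then have "(p, q) \<in> ?R\<^sup>*" using assms s by (meson rtrancl_trans symD)
  then show ?thesis using assms L_vertices_subset by (auto simp: L_equiv_def)
qed

lemma single_singularity: "\<exists>!X. singular X"
proof (rule ex1I)
  have v: "pt 0 0 \<in> L_vertices" by (auto simp: L_vertices_def)
  have m: "pt 0 0 \<in> L_equiv `` {pt 0 0}" using L_vertices_equiv[OF v v] by auto
  have q: "L_equiv `` {pt 0 0} \<in> golden_L"
    unfolding golden_L_def using v L_vertices_subset by (blast intro: quotientI)
  show "singular (L_equiv `` {pt 0 0})" using m q v by (auto simp: singular_def)
  fix X assume "singular X"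
  then obtain p where p: "p \<in> X" "p \<in> L_vertices" "X \<in> L_polygon // L_equiv"
    by (auto simp: singular_def golden_L_def)
  show "X = L_equiv `` {pt 0 0}"
    by (rule quotient_eqI[OF equiv_L_equiv p(3) _ p(1) m L_vertices_equiv[OF p(2) v]])
      (use q in \<open>simp add: golden_L_def\<close>)
qed

lemma sigma_simps:
  "sigma 0 *v v = pt (v $ 1 + phi * v $ 2) (v $ 2)"
  "sigma (Suc 0) *v v = pt (phi * v $ 1 + phi * v $ 2) (v $ 1 + phi * v $ 2)"
  "sigma 2 *v v = pt (phi * v $ 1 + v $ 2) (phi * v $ 1 + phi * v $ 2)"
  "sigma 3 *v v = pt (v $ 1) (phi * v $ 1 + v $ 2)"
  by (simp_all add: sigma_def vec_eq_iff forall_2 matrix_vector_mult_def sum_2)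

lemma sector_eq:
  "sector 0 = {v \<in> Sigma_sector. v $ 2 < v $ 1 / phi}"
  "sector (Suc 0) = {v \<in> Sigma_sector. v $ 1 / phi \<le> v $ 2 \<and> v $ 2 < v $ 1}"
  "sector 2 = {v \<in> Sigma_sector. v $ 1 \<le> v $ 2 \<and> v $ 2 < phi * v $ 1}"
  "sector 3 = {v \<in> Sigma_sector. phi * v $ 1 \<le> v $ 2}"
proof -
  note b = phi_bounds and q = phi_square
  have b0: "phi > 0" using b by simp
  have im: "sector k = {v. \<exists>u \<in> Sigma_sector. v = sigma k *v u}" for k
    by (auto simp: sector_def)
  have eq: "A = B" if "\<And>x y. pt x y \<in> A \<longleftrightarrow> pt x y \<in> B" for A B :: "(real^2) set"
  proof -
    have "v = pt (v $ 1) (v $ 2)" for v :: "real^2" by (simp add: vec_eq_iff forall_2)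
    then show ?thesis using that by (metis subsetI subset_antisym)
  qed
  have ex: "(\<exists>u \<in> Sigma_sector. P (u $ 1) (u $ 2)) \<longleftrightarrow> (\<exists>a>0. \<exists>b\<ge>0. P a b)" for P
  proof
    assume "\<exists>a>0. \<exists>b\<ge>0. P a b"
    then obtain a b where "a > 0" "b \<ge> 0" "P a b" by blast
    then show "\<exists>u \<in> Sigma_sector. P (u $ 1) (u $ 2)"
      by (intro bexI[of _ "pt a b"]) (auto simp: Sigma_sector_def)
  qed (auto simp: Sigma_sector_def)
  have cancel: "phi * (phi * a) = phi * a + a" for a
    using q by (metis distrib_right mult.assoc mult_1)
  show "sector 0 = {v \<in> Sigma_sector. v $ 2 < v $ 1 / phi}"
  proof (rule eq)
    fix x y :: real
    have "(\<exists>a>0. \<exists>b\<ge>0. x = a + phi * b \<and> y = b) \<longleftrightarrow> x > 0 \<and> y \<ge> 0 \<and> y < x / phi"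
    proof
      assume "x > 0 \<and> y \<ge> 0 \<and> y < x / phi"
      then show "\<exists>a>0. \<exists>b\<ge>0. x = a + phi * b \<and> y = b"
        using b0 by (intro exI[of _ "x - phi * y"] exI[of _ y] conjI) (auto simp: field_simps)
    qed (use b0 in \<open>auto simp: field_simps intro: add_pos_nonneg\<close>)
    then show "pt x y \<in> sector 0 \<longleftrightarrow> pt x y \<in> {v \<in> Sigma_sector. v $ 2 < v $ 1 / phi}"
      by (simp add: im sigma_simps pt_eq_iff ex[where P = "\<lambda>a b. x = a + phi * b \<and> y = b"])
        (simp add: Sigma_sector_def)
  qed
  show "sector (Suc 0) = {v \<in> Sigma_sector. v $ 1 / phi \<le> v $ 2 \<and> v $ 2 < v $ 1}"
  proof (rule eq)
    fix x y :: real
    have "(\<exists>a>0. \<exists>b\<ge>0. x = phi * a + phi * b \<and> y = a + phi * b)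
            \<longleftrightarrow> x > 0 \<and> y \<ge> 0 \<and> x / phi \<le> y \<and> y < x"
    proof
      assume h: "x > 0 \<and> y \<ge> 0 \<and> x / phi \<le> y \<and> y < x"
      have "x = phi * (phi * (x - y)) + phi * (phi * y - x)"
        "y = phi * (x - y) + phi * (phi * y - x)"
        by (simp_all add: algebra_simps cancel)
      then show "\<exists>a>0. \<exists>b\<ge>0. x = phi * a + phi * b \<and> y = a + phi * b"
        using h b0 by (intro exI[of _ "phi * (x - y)"] exI[of _ "phi * y - x"] conjI)
          (auto simp: field_simps)
    next
      assume "\<exists>a>0. \<exists>b\<ge>0. x = phi * a + phi * b \<and> y = a + phi * b"
      then obtain a b where h: "a > 0" "b \<ge> 0" "x = phi * a + phi * b" "y = a + phi * b" by blast
      have "phi * a > a" "phi * b \<ge> b"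
        using h b mult_right_mono[of 1 phi b] by auto
      moreover have "x / phi = a + b" using h b0 by (simp add: field_simps)
      ultimately show "x > 0 \<and> y \<ge> 0 \<and> x / phi \<le> y \<and> y < x" using h by linarith
    qed
    then show "pt x y \<in> sector (Suc 0) \<longleftrightarrow>
        pt x y \<in> {v \<in> Sigma_sector. v $ 1 / phi \<le> v $ 2 \<and> v $ 2 < v $ 1}"
      by (simp add: im sigma_simps pt_eq_iff
          ex[where P = "\<lambda>a b. x = phi * a + phi * b \<and> y = a + phi * b"])
        (simp add: Sigma_sector_def)
  qed
  show "sector 2 = {v \<in> Sigma_sector. v $ 1 \<le> v $ 2 \<and> v $ 2 < phi * v $ 1}"
  proof (rule eq)
    fix x y :: real
    have "(\<exists>a>0. \<exists>b\<ge>0. x = phi * a + b \<and> y = phi * a + phi * b)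
            \<longleftrightarrow> x > 0 \<and> y \<ge> 0 \<and> x \<le> y \<and> y < phi * x"
    proof
      assume h: "x > 0 \<and> y \<ge> 0 \<and> x \<le> y \<and> y < phi * x"
      have "x = phi * (phi * x - y) + phi * (y - x)"
        "y = phi * (phi * x - y) + phi * (phi * (y - x))"
        by (simp_all add: algebra_simps cancel)
      then show "\<exists>a>0. \<exists>b\<ge>0. x = phi * a + b \<and> y = phi * a + phi * b"
        using h b0 by (intro exI[of _ "phi * x - y"] exI[of _ "phi * (y - x)"] conjI)
          (auto simp: field_simps)
    next
      assume "\<exists>a>0. \<exists>b\<ge>0. x = phi * a + b \<and> y = phi * a + phi * b"
      then obtain a b where h: "a > 0" "b \<ge> 0" "x = phi * a + b" "y = phi * a + phi * b" by blast
      have "phi * a > a" "phi * b \<ge> b"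
        using h b mult_right_mono[of 1 phi b] by auto
      moreover have "phi * x = phi * a + a + phi * b" using h by (simp add: algebra_simps cancel)
      ultimately show "x > 0 \<and> y \<ge> 0 \<and> x \<le> y \<and> y < phi * x" using h by linarith
    qed
    then show "pt x y \<in> sector 2 \<longleftrightarrow>
        pt x y \<in> {v \<in> Sigma_sector. v $ 1 \<le> v $ 2 \<and> v $ 2 < phi * v $ 1}"
      by (simp add: im sigma_simps pt_eq_iff
          ex[where P = "\<lambda>a b. x = phi * a + b \<and> y = phi * a + phi * b"])
        (simp add: Sigma_sector_def)
  qed
  show "sector 3 = {v \<in> Sigma_sector. phi * v $ 1 \<le> v $ 2}"
  proof (rule eq)
    fix x y :: real
    have "(\<exists>a>0. \<exists>b\<ge>0. x = a \<and> y = phi * a + b) \<longleftrightarrow> x > 0 \<and> y \<ge> 0 \<and> phi * x \<le> y"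
    proof
      assume "x > 0 \<and> y \<ge> 0 \<and> phi * x \<le> y"
      then show "\<exists>a>0. \<exists>b\<ge>0. x = a \<and> y = phi * a + b"
        by (intro exI[of _ x] exI[of _ "y - phi * x"] conjI) auto
    qed (use b0 in auto)
    then show "pt x y \<in> sector 3 \<longleftrightarrow> pt x y \<in> {v \<in> Sigma_sector. phi * v $ 1 \<le> v $ 2}"
      by (simp add: im sigma_simps pt_eq_iff ex[where P = "\<lambda>a b. x = a \<and> y = phi * a + b"])
        (simp add: Sigma_sector_def)
  qed
qed

lemma sector_index_ex1:
  assumes "v \<in> Sigma_sector"
  shows "\<exists>!k. k < 4 \<and> v \<in> sector k"
proof -
  have pos: "v $ 1 > 0" using assms by (simp add: Sigma_sector_def)
  have 1: "v $ 1 / phi < v $ 1" "v $ 1 < phi * v $ 1" using pos phi_bounds by (auto simp: field_simps)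
  have 2: "k < 4 \<longleftrightarrow> k = 0 \<or> k = Suc 0 \<or> k = 2 \<or> k = 3" for k :: nat by auto
  show ?thesis
    unfolding 2 Ex1_def using 1 assms sector_eq
    by (cases "v $ 2 < v $ 1 / phi"; cases "v $ 2 < v $ 1"; cases "v $ 2 < phi * v $ 1") auto
qed

end

theory Submission
  imports Defs
begin

text \<open>
  The horizontal shear by \<open>phi\<close>, the swap of the coordinates and the reflection in the vertical axis
  are derivatives of affine automorphisms of the golden L, and \<open>sigma 0, \<dots>, sigma 3\<close> and their
  inverses are products of these. So they transport periodic trajectories and saddle connections,
  and the saddle connections in the direction of a product of the \<open>sigma k\<close> applied to \<open>(1, 0)\<close>
  are the images of the horizontal ones, whose lengths are \<open>1\<close> and \<open>1 / phi\<close>.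

  For termination of the itinerary, look at the holonomy of a closed trajectory. If it lies in the
  open first quadrant, each crossing of a side adds \<open>1\<close> or \<open>phi\<close> to a coordinate, so both
  coordinates are of the form \<open>a + b * phi\<close> with natural \<open>a, b\<close>, hence at least \<open>1\<close>. Applying the
  inverse of \<open>sigma k\<close> gives the holonomy of another closed trajectory, and as long as it stays in
  the open quadrant the sum of the coordinates drops by at least \<open>1\<close>.
\<close>

section \<open>The equivalence relation of the surface\<close>

lemma pt_components: "v = pt (v $ 1) (v $ 2)"
  by (simp add: vec_eq_iff forall_2)

lemma in_L_polygon_iff:
  "p \<in> L_polygon \<longleftrightarrow> 0 \<le> p $ 1 \<and> 0 \<le> p $ 2 \<and> p $ 1 \<le> phi \<and> p $ 2 \<le> phi \<and> (p $ 1 \<le> 1 \<or> p $ 2 \<le> 1)"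
proof -
  have "pt x y \<in> L_polygon \<longleftrightarrow> 0 \<le> x \<and> 0 \<le> y \<and> x \<le> phi \<and> y \<le> phi \<and> (x \<le> 1 \<or> y \<le> 1)" for x y
    using phi_bounds by (auto simp: L_polygon_def pt_eq_iff)
  from this[of "p $ 1" "p $ 2"] show ?thesis by (simp flip: pt_components)
qed

lemma in_L_vertices_iff:
  "p \<in> L_vertices \<longleftrightarrow> (p $ 1, p $ 2) \<in> {(0,0), (1,0), (phi,0), (phi,1), (1,1), (1,phi), (0,phi), (0,1)}"
proof -
  have "pt x y \<in> L_vertices \<longleftrightarrow> (x, y) \<in> {(0,0), (1,0), (phi,0), (phi,1), (1,1), (1,phi), (0,phi), (0,1)}" for x y
    by (auto simp: L_vertices_def pt_eq_iff)
  from this[of "p $ 1" "p $ 2"] show ?thesis by (simp flip: pt_components)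
qed

lemma side_gluing_iff:
  "(p, q) \<in> side_gluing \<longleftrightarrow>
     (p $ 1 = phi \<and> q $ 1 = 0 \<and> p $ 2 = q $ 2 \<and> 0 \<le> p $ 2 \<and> p $ 2 \<le> 1) \<or>
     (p $ 1 = 1 \<and> q $ 1 = 0 \<and> p $ 2 = q $ 2 \<and> 1 \<le> p $ 2 \<and> p $ 2 \<le> phi) \<or>
     (p $ 2 = 1 \<and> q $ 2 = 0 \<and> p $ 1 = q $ 1 \<and> 1 \<le> p $ 1 \<and> p $ 1 \<le> phi) \<or>
     (p $ 2 = phi \<and> q $ 2 = 0 \<and> p $ 1 = q $ 1 \<and> 0 \<le> p $ 1 \<and> p $ 1 \<le> 1)"
proof -
  have "(pt x y, pt x' y') \<in> side_gluing \<longleftrightarrow>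
     (x = phi \<and> x' = 0 \<and> y = y' \<and> 0 \<le> y \<and> y \<le> 1) \<or>
     (x = 1 \<and> x' = 0 \<and> y = y' \<and> 1 \<le> y \<and> y \<le> phi) \<or>
     (y = 1 \<and> y' = 0 \<and> x = x' \<and> 1 \<le> x \<and> x \<le> phi) \<or>
     (y = phi \<and> y' = 0 \<and> x = x' \<and> 0 \<le> x \<and> x \<le> 1)" for x y x' y'
    by (auto simp: side_gluing_def pt_eq_iff)
  from this[of "p $ 1" "p $ 2" "q $ 1" "q $ 2"] show ?thesis by (simp flip: pt_components)
qed

lemma side_gluing_polygon: "(p, q) \<in> side_gluing \<Longrightarrow> p \<in> L_polygon \<and> q \<in> L_polygon"
  using phi_bounds by (auto simp: side_gluing_iff in_L_polygon_iff)

lemma side_gluing_vertices: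
  assumes "(p, q) \<in> side_gluing"
  shows "p \<in> L_vertices \<longleftrightarrow> q \<in> L_vertices"
  using assms unfolding side_gluing_iff
  by (elim disjE conjE) (use phi_bounds in \<open>simp_all add: in_L_vertices_iff, blast+\<close>)

text \<open>A boundary point that is no vertex lies on exactly one side and so has a single partner;
  a second gluing step through it must return to the start.\<close>

lemma side_gluing_functional:
  assumes "(p, q) \<in> side_gluing \<union> side_gluing\<inverse>" "(q, r) \<in> side_gluing \<union> side_gluing\<inverse>" "q \<notin> L_vertices"
  shows "p = r"
proof -
  have eqI: "a = b" if "a $ 1 = b $ 1" "a $ 2 = b $ 2" for a b :: "real^2"
    using that by (simp add: vec_eq_iff forall_2)
  have pos: "0 < phi" "phi \<noteq> 0" "phi \<noteq> 1" "\<not> phi \<le> 1" "\<not> phi \<le> 0" using phi_bounds by auto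
  \<comment> \<open>Gluing leads from right or upper sides to left or lower sides, and a side of the
    first kind meets one of the second kind only in vertices.\<close>
  have compose: False if "(a, b) \<in> side_gluing" "(b, c) \<in> side_gluing" "b \<notin> L_vertices" for a b c
    using that pos unfolding side_gluing_iff
    by (elim disjE conjE) (simp_all add: in_L_vertices_iff)
  have left: "a = c" if "(a, b) \<in> side_gluing" "(c, b) \<in> side_gluing" "b \<notin> L_vertices" for a b c
    using that pos unfolding side_gluing_iff
    by (elim disjE conjE) (simp_all add: in_L_vertices_iff eqI)
  have right: "a = c" if "(b, a) \<in> side_gluing" "(b, c) \<in> side_gluing" "b \<notin> L_vertices" for a b c
    using that pos unfolding side_gluing_iff
    by (elim disjE conjE) (simp_all add: in_L_vertices_iff eqI)
  show ?thesis using assms compose left right by blast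
qed

text \<open>Removes the transitive closure: away from the vertices a chain of gluings only runs back
  and forth between two points, and a chain that meets a vertex stays among the vertices, which are
  all equivalent.\<close>

lemma L_equiv_iff:
  "(p, q) \<in> L_equiv \<longleftrightarrow> p \<in> L_polygon \<and> q \<in> L_polygon \<and>
     (p = q \<or> (p, q) \<in> side_gluing \<or> (q, p) \<in> side_gluing \<or> p \<in> L_vertices \<and> q \<in> L_vertices)"
    (is "_ \<longleftrightarrow> ?E p q")
proof
  have "p = q \<or> (p, q) \<in> side_gluing \<or> (q, p) \<in> side_gluing \<or> p \<in> L_vertices \<and> q \<in> L_vertices"
    if "(p, q) \<in> (side_gluing \<union> side_gluing\<inverse>)\<^sup>*" for p q
    using that
  proof (induction rule: rtrancl_induct)
    case (step q r)
    have "q \<in> L_vertices \<longleftrightarrow> r \<in> L_vertices"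
      using step.hyps(2) side_gluing_vertices by blast
    moreover have "p = r" if "q \<notin> L_vertices" "(p, q) \<in> side_gluing \<or> (q, p) \<in> side_gluing"
      using side_gluing_functional[OF _ step.hyps(2)] that by blast
    moreover have "p \<in> L_vertices" if "q \<in> L_vertices"
      using step.IH that side_gluing_vertices by blast
    ultimately show ?case using step by blast
  qed auto
  then show "(p, q) \<in> L_equiv \<Longrightarrow> ?E p q" by (simp add: L_equiv_def)
next
  assume "?E p q"
  then show "(p, q) \<in> L_equiv"
    using L_vertices_equiv[of p q] by (auto simp: L_equiv_def intro: r_into_rtrancl)
qed

lemma L_equiv_refl: "p \<in> L_polygon \<Longrightarrow> (p, p) \<in> L_equiv"
  by (simp add: L_equiv_iff)

lemma L_equiv_sym: "(p, q) \<in> L_equiv \<Longrightarrow> (q, p) \<in> L_equiv"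
  by (auto simp: L_equiv_iff)

lemma L_equiv_trans: "(p, q) \<in> L_equiv \<Longrightarrow> (q, r) \<in> L_equiv \<Longrightarrow> (p, r) \<in> L_equiv"
  using equiv_L_equiv by (auto simp: equiv_def dest: transD)

lemma L_equiv_vertices: "(p, q) \<in> L_equiv \<Longrightarrow> p \<in> L_vertices \<longleftrightarrow> q \<in> L_vertices"
  using side_gluing_vertices by (auto simp: L_equiv_iff)

lemma golden_L_classI: "p \<in> L_polygon \<Longrightarrow> L_equiv `` {p} \<in> golden_L"
  by (simp add: golden_L_def quotientI)

lemma golden_L_eq_class:
  assumes "X \<in> golden_L" "p \<in> X"
  shows "X = L_equiv `` {p}"
  using assms equiv_L_equiv unfolding golden_L_def by (metis Image_singleton_iff equiv_class_eq quotientE)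

lemma golden_L_equiv: "X \<in> golden_L \<Longrightarrow> p \<in> X \<Longrightarrow> q \<in> X \<Longrightarrow> (p, q) \<in> L_equiv"
  using golden_L_eq_class by fastforce

lemma golden_L_nonempty: "X \<in> golden_L \<Longrightarrow> \<exists>p. p \<in> X"
  using equiv_L_equiv in_quotient_imp_non_empty unfolding golden_L_def by blast

lemma golden_L_subset: "X \<in> golden_L \<Longrightarrow> p \<in> X \<Longrightarrow> p \<in> L_polygon"
  using golden_L_equiv L_equiv_iff by blast

lemma singular_iff: "X \<in> golden_L \<Longrightarrow> p \<in> X \<Longrightarrow> singular X \<longleftrightarrow> p \<in> L_vertices"
  using golden_L_equiv L_equiv_vertices by (fastforce simp: singular_def)

lemma straight_path_golden_L: "straight_path I w \<gamma> \<Longrightarrow> t \<in> I \<Longrightarrow> \<gamma> t \<in> golden_L"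
  by (simp add: straight_path_def)

section \<open>Affine automorphisms\<close>

text \<open>\<open>A\<close> is the derivative of \<open>F\<close>. The parameter set
  \<open>I\<close> is arbitrary, so that closed trajectories (\<open>UNIV\<close>) and saddle
  connections (\<open>{0..1}\<close>) are both covered, and time is kept, so that periods
  survive.\<close>

definition affine_map_on_L :: "(real^2 \<Rightarrow> real^2) \<Rightarrow> ((real^2) set \<Rightarrow> (real^2) set) \<Rightarrow> bool" where
  "affine_map_on_L A F \<longleftrightarrow>
     (\<forall>X\<in>golden_L. F X \<in> golden_L \<and> (singular (F X) \<longleftrightarrow> singular X)) \<and>
     (\<forall>I w \<gamma>. straight_path I w \<gamma> \<longrightarrow> straight_path I (A w) (F \<circ> \<gamma>))"

text \<open>Bijectivity of \<open>F\<close> is not demanded: the inverse of the shear by \<open>phi\<close> is its conjugate by a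
  reflection, so inverse matrices are handled by the closure under composition.\<close>

definition veech :: "(real^2 \<Rightarrow> real^2) \<Rightarrow> bool" where
  "veech A \<longleftrightarrow> (\<exists>F. affine_map_on_L A F)"

lemma veech_comp: "veech A \<Longrightarrow> veech B \<Longrightarrow> veech (A \<circ> B)"
proof -
  assume "veech A" "veech B"
  then obtain F G where "affine_map_on_L A F" "affine_map_on_L B G" by (auto simp: veech_def)
  then have "affine_map_on_L (A \<circ> B) (F \<circ> G)"
    by (auto simp: affine_map_on_L_def o_assoc[symmetric])
  then show ?thesis by (auto simp: veech_def)
qed

section \<open>Germs of segments in convex pieces\<close>

text \<open>The parameters at which a ray lies in a convex set form an interval. It either misses
  all small positive parameters or reaches down to 0, and then contains an initial stretch.\<close>

lemma segment_germ:
  assumes "convex P"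
  shows "\<exists>e>0. (\<forall>s\<in>{0<..e}. p + s *\<^sub>R w \<in> P) \<or> (\<forall>s\<in>{0<..e}. p + s *\<^sub>R w \<notin> P)"
proof (cases "\<exists>e>0. \<forall>s\<in>{0<..e}. p + s *\<^sub>R w \<notin> P")
  case False
  then have small: "\<exists>s\<in>{0<..e}. p + s *\<^sub>R w \<in> P" if "e > 0" for e using that by blast
  from small[of 1] obtain e where e: "e > 0" "p + e *\<^sub>R w \<in> P" by auto
  have "p + s *\<^sub>R w \<in> P" if s: "s \<in> {0<..e}" for s
  proof -
    obtain r where r: "r \<in> {0<..s}" "p + r *\<^sub>R w \<in> P" using small[of s] s by auto
    have "convex ((\<lambda>s. p + s *\<^sub>R w) -` P)"
      using convex_linear_vimage[OF linear_scale_left convex_translation[OF assms, of "-p"], of w]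
      by (rule back_subst[of convex]) (auto simp: image_iff algebra_simps intro: exI[of _ "p + _"])
    then have "is_interval ((\<lambda>s. p + s *\<^sub>R w) -` P)" by (simp add: is_interval_convex_1)
    then show ?thesis using mem_is_interval_1_I[of "(\<lambda>s. p + s *\<^sub>R w) -` P" r e s] e r s by simp
  qed
  then show ?thesis using e by blast
qed blast

lemma segment_germ_finite:
  assumes "finite \<P>" "\<And>P. P \<in> \<P> \<Longrightarrow> convex P"
  shows "\<exists>e>0. \<forall>P\<in>\<P>. (\<forall>s\<in>{0<..e}. p + s *\<^sub>R w \<in> P) \<or> (\<forall>s\<in>{0<..e}. p + s *\<^sub>R w \<notin> P)"
  using assms
proof (induction rule: finite_induct)
  case empty
  then show ?case by (auto intro: exI[of _ 1])
next
  case (insert P \<P>)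
  then obtain e where "e > 0" "\<forall>P\<in>\<P>. (\<forall>s\<in>{0<..e}. p + s *\<^sub>R w \<in> P) \<or> (\<forall>s\<in>{0<..e}. p + s *\<^sub>R w \<notin> P)"
    by auto
  moreover obtain d where "d > 0" "(\<forall>s\<in>{0<..d}. p + s *\<^sub>R w \<in> P) \<or> (\<forall>s\<in>{0<..d}. p + s *\<^sub>R w \<notin> P)"
    using segment_germ[of P p w] insert.prems by blast
  moreover have "{0<..min d e} \<subseteq> {0<..d}" "{0<..min d e} \<subseteq> {0<..e}" by auto
  ultimately have "min d e > 0" "\<forall>Q\<in>insert P \<P>. (\<forall>s\<in>{0<..min d e}. p + s *\<^sub>R w \<in> Q) \<or> (\<forall>s\<in>{0<..min d e}. p + s *\<^sub>R w \<notin> Q)"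
    by (simp, blast)
  then show ?case by blast
qed

text \<open>A short germ cannot alternate between finitely many convex pieces. \<open>S\<close>
  collects the admissible times: beyond an end of the parameter interval of a path nothing is known
  of the points.\<close>

lemma piecewise_affine_germ:
  assumes fin: "finite \<P>"
    and conv: "\<And>P c. (P, c) \<in> \<P> \<Longrightarrow> closed P \<and> convex P"
    and cover: "\<And>p. p \<in> L_polygon \<Longrightarrow> \<exists>P c. (P, c) \<in> \<P> \<and> p \<in> P"
    and e: "e > 0" and p: "p \<in> L_polygon"
    and path: "\<And>s. s \<in> {0..e} \<Longrightarrow> s \<in> S \<Longrightarrow> p + s *\<^sub>R w \<in> L_polygon"
  shows "\<exists>d>0. d \<le> e \<and> (\<exists>P c. (P, c) \<in> \<P> \<and> p \<in> P \<and> (\<forall>s\<in>{0..d}. s \<in> S \<longrightarrow> p + s *\<^sub>R w \<in> P))"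
proof -
  obtain d where d: "d > 0"
    "\<forall>P\<in>fst ` \<P>. (\<forall>s\<in>{0<..d}. p + s *\<^sub>R w \<in> P) \<or> (\<forall>s\<in>{0<..d}. p + s *\<^sub>R w \<notin> P)"
  proof -
    have "finite (fst ` \<P>)" "\<And>P. P \<in> fst ` \<P> \<Longrightarrow> convex P" using fin conv by auto
    from segment_germ_finite[OF this, of p w] show ?thesis using that by blast
  qed
  show ?thesis
  proof (cases "\<exists>s\<in>{0<..min d e}. s \<in> S")
    case True
    then obtain s where s: "s \<in> {0<..min d e}" "s \<in> S" by blast
    obtain P c where P: "(P, c) \<in> \<P>" "p + s *\<^sub>R w \<in> P" using path[of s] s cover by force
    then have in_P: "\<forall>s\<in>{0<..d}. p + s *\<^sub>R w \<in> P" using d s by fastforce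
    \<comment> \<open>The piece is closed, so with the points just after \<open>p\<close> it
      contains \<open>p\<close> itself.\<close>
    have "((\<lambda>s. p + s *\<^sub>R w) \<longlongrightarrow> p + 0 *\<^sub>R w) (at_right 0)"
      by (intro tendsto_intros)
    moreover have "eventually (\<lambda>s. p + s *\<^sub>R w \<in> P) (at_right 0)"
      using in_P d(1) by (auto simp: eventually_at_right_field intro!: exI[of _ d])
    ultimately have "p + 0 *\<^sub>R w \<in> P"
      using conv[OF P(1)] by (intro Lim_in_closed_set[of P _ "at_right 0"]) auto
    then have "p \<in> P" "\<forall>s\<in>{0..d}. p + s *\<^sub>R w \<in> P" using in_P by (force simp: less_le)+
    then show ?thesis using P(1) d(1) e by (intro exI[of _ "min d e"]) auto
  next
    case False
    \<comment> \<open>Up to \<open>min d e\<close> only the time 0 can be admissible, so any piece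
      containing \<open>p\<close> serves.\<close>
    obtain P c where P: "(P, c) \<in> \<P>" "p \<in> P" using p cover by blast
    have "p + s *\<^sub>R w \<in> P" if "s \<in> {0..min d e}" "s \<in> S" for s
      using False that P(2) by (cases "s = 0") auto
    then show ?thesis using P d(1) e by (intro exI[of _ "min d e"]) auto
  qed
qed

text \<open>Merges future and past germs by a sign \<open>\<epsilon>\<close>, so that one argument
  treats both.\<close>

lemma straight_path_iff:
  "straight_path I w \<gamma> \<longleftrightarrow>
     (\<forall>t\<in>I. \<gamma> t \<in> golden_L) \<and>
     (\<forall>t\<in>I. \<forall>\<epsilon>\<in>{1,-1}. \<exists>e>0. \<exists>p\<in>\<gamma> t. \<forall>s\<in>{0..e}. t + \<epsilon> * s \<in> I \<longrightarrow> p + s *\<^sub>R (\<epsilon> *\<^sub>R w) \<in> \<gamma> (t + \<epsilon> * s))"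
  by (simp add: straight_path_def) blast

text \<open>The pieces are closed and convex, so a germ of a segment starting at any point stays in a single
  piece; it is therefore enough that the affine maps agree, up to the gluing, on overlaps and on sides.\<close>

lemma veech_piecewise:
  assumes lin: "linear A"
    and fin: "finite \<P>"
    and conv: "\<And>P c. (P, c) \<in> \<P> \<Longrightarrow> closed P \<and> convex P"
    and cover: "\<And>p. p \<in> L_polygon \<Longrightarrow> \<exists>P c. (P, c) \<in> \<P> \<and> p \<in> P"
    and vert: "\<And>P c p. (P, c) \<in> \<P> \<Longrightarrow> p \<in> P \<Longrightarrow> A p + c \<in> L_vertices \<longleftrightarrow> p \<in> L_vertices"
    and overlap: "\<And>P c Q d p. (P, c) \<in> \<P> \<Longrightarrow> (Q, d) \<in> \<P> \<Longrightarrow> p \<in> P \<Longrightarrow> p \<in> Q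
      \<Longrightarrow> (A p + c, A p + d) \<in> L_equiv"
    and glue: "\<And>p q. (p, q) \<in> side_gluing
      \<Longrightarrow> \<exists>P c Q d. (P, c) \<in> \<P> \<and> (Q, d) \<in> \<P> \<and> p \<in> P \<and> q \<in> Q \<and> (A p + c, A q + d) \<in> L_equiv"
  shows "veech A"
proof -
  \<comment> \<open>A class goes to everything equivalent to an image of one of its points;
    \<open>equiv\<close> below makes this independent of the point and of the piece.\<close>
  define F where "F X = {r. \<exists>p\<in>X. \<exists>P c. (P, c) \<in> \<P> \<and> p \<in> P \<and> (A p + c, r) \<in> L_equiv}" for X
  have equiv: "(A p + c, A q + d) \<in> L_equiv"
    if pq: "(p, q) \<in> L_equiv" and "(P, c) \<in> \<P>" "p \<in> P" "(Q, d) \<in> \<P>" "q \<in> Q" for p q P c Q d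
  proof -
    \<comment> \<open>\<open>glue\<close> provides one pair of pieces for two glued points;
      \<open>overlap\<close> extends its conclusion to every pair of pieces containing them.\<close>
    have sg: "(A p + c, A q + d) \<in> L_equiv" if pq: "(p, q) \<in> side_gluing"
      and "(P, c) \<in> \<P>" "p \<in> P" "(Q, d) \<in> \<P>" "q \<in> Q" for p q P c Q d
      using that glue[OF pq] overlap L_equiv_trans by meson
    consider "p = q" | "(p, q) \<in> side_gluing" | "(q, p) \<in> side_gluing" | "p \<in> L_vertices" "q \<in> L_vertices"
      using pq unfolding L_equiv_iff by blast
    then show ?thesis
    proof cases
      case 4
      then show ?thesis using vert that by (intro L_vertices_equiv) auto
    qed (use that overlap sg L_equiv_sym in blast)+
  qed
  have F_class: "F X = L_equiv `` {A p + c}" if "X \<in> golden_L" "p \<in> X" "(P, c) \<in> \<P>" "p \<in> P" for X p P c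
    using that equiv[OF golden_L_equiv[of X p]] L_equiv_trans L_equiv_sym unfolding F_def by blast
  have image: "A p + c \<in> L_polygon" if "(P, c) \<in> \<P>" "p \<in> P" for P c p
    using overlap[OF that(1) that(1) that(2) that(2)] by (simp add: L_equiv_iff)
  have F_in: "A p + c \<in> F X" if "X \<in> golden_L" "p \<in> X" "(P, c) \<in> \<P>" "p \<in> P" for X p P c
    using F_class[OF that] L_equiv_refl image that by blast
  have F_golden: "F X \<in> golden_L" if X: "X \<in> golden_L" for X
  proof -
    obtain p where p: "p \<in> X" using golden_L_nonempty X by blast
    moreover obtain P c where "(P, c) \<in> \<P>" "p \<in> P" using cover golden_L_subset X p by blast
    ultimately show ?thesis using F_class[of X p P c] golden_L_classI image X p by simp
  qed
  have F_singular: "singular (F X) \<longleftrightarrow> singular X" if X: "X \<in> golden_L" for X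
  proof -
    obtain p where p: "p \<in> X" using golden_L_nonempty X by blast
    obtain P c where P: "(P, c) \<in> \<P>" "p \<in> P" using cover golden_L_subset X p by blast
    show ?thesis
      using singular_iff[OF X p] singular_iff[OF F_golden[OF X] F_in[OF X p P]] vert[OF P] by simp
  qed
  have "straight_path I (A w) (F \<circ> \<gamma>)" if sp: "straight_path I w \<gamma>" for I w \<gamma>
    unfolding straight_path_iff
  proof (intro conjI ballI)
    note gl = straight_path_golden_L[OF sp]
    show "(F \<circ> \<gamma>) t \<in> golden_L" if "t \<in> I" for t using gl F_golden that by simp
    fix t and \<epsilon> :: real assume t: "t \<in> I" and \<epsilon>: "\<epsilon> \<in> {1, -1}"
    then obtain e p where e: "e > 0" "p \<in> \<gamma> t"
      "\<forall>s\<in>{0..e}. t + \<epsilon> * s \<in> I \<longrightarrow> p + s *\<^sub>R (\<epsilon> *\<^sub>R w) \<in> \<gamma> (t + \<epsilon> * s)"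
      using sp unfolding straight_path_iff by blast
    \<comment> \<open>Within one piece the map is a single affine map, so it takes the shortened
      germ to a segment with velocity \<open>\<epsilon> *\<^sub>R A w\<close>.\<close>
    obtain d P c where d: "d > 0" "d \<le> e" "(P, c) \<in> \<P>" "p \<in> P"
      "\<forall>s\<in>{0..d}. t + \<epsilon> * s \<in> I \<longrightarrow> p + s *\<^sub>R (\<epsilon> *\<^sub>R w) \<in> P"
    proof -
      have "p \<in> L_polygon" using golden_L_subset gl t e(2) by blast
      moreover have "p + s *\<^sub>R (\<epsilon> *\<^sub>R w) \<in> L_polygon" if "s \<in> {0..e}" "s \<in> {s. t + \<epsilon> * s \<in> I}" for s
        using golden_L_subset gl e(3) that by blast
      ultimately show ?thesis
        using piecewise_affine_germ[where \<P> = \<P> and p = p and e = e and w = "\<epsilon> *\<^sub>R w" and S = "{s. t + \<epsilon> * s \<in> I}"]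
          fin conv cover e(1) that by blast
    qed
    have "A p + c + s *\<^sub>R (\<epsilon> *\<^sub>R A w) \<in> (F \<circ> \<gamma>) (t + \<epsilon> * s)" if "s \<in> {0..d}" "t + \<epsilon> * s \<in> I" for s
    proof -
      have "A (p + s *\<^sub>R (\<epsilon> *\<^sub>R w)) + c \<in> F (\<gamma> (t + \<epsilon> * s))"
        using that d e(3) by (intro F_in[OF gl]) auto
      then show ?thesis using lin by (simp add: linear_add linear_cmul add_ac)
    qed
    moreover have "A p + c \<in> (F \<circ> \<gamma>) t" using F_in gl t e d by simp
    ultimately show "\<exists>e>0. \<exists>p\<in>(F \<circ> \<gamma>) t. \<forall>s\<in>{0..e}. t + \<epsilon> * s \<in> I \<longrightarrow> p + s *\<^sub>R (\<epsilon> *\<^sub>R A w) \<in> (F \<circ> \<gamma>) (t + \<epsilon> * s)"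
      using d(1) by blast
  qed
  then have "affine_map_on_L A F" using F_golden F_singular by (simp add: affine_map_on_L_def)
  then show ?thesis by (auto simp: veech_def)
qed

section \<open>Pieces given by linear inequalities\<close>

text \<open>Half-planes as triples let membership unfold to linear inequalities, while closedness
  and convexity hold for every \<open>H\<close>.\<close>

definition piece :: "(real \<times> real \<times> real) set \<Rightarrow> (real^2) set" where
  "piece H = {p. \<forall>(a, b, c)\<in>H. a * p $ 1 + b * p $ 2 \<le> c}"

lemma closed_convex_piece: "closed (piece H) \<and> convex (piece H)"
proof -
  have "piece H = (\<Inter>(a, b, c)\<in>H. {p. pt a b \<bullet> p \<le> c})"
    by (auto simp: piece_def inner_vec_def sum_2)
  then show ?thesis
    by (auto intro!: closed_INT convex_INT closed_halfspace_le convex_halfspace_le)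
qed

lemma linear_pt: "linear (\<lambda>v::real^2. pt (a * v $ 1 + b * v $ 2) (c * v $ 1 + d * v $ 2))"
  by (rule linearI) (simp_all add: vec_eq_iff forall_2 algebra_simps)

text \<open>\<open>veech_piecewise\<close> in coordinates, so that its conditions become statements
  about real numbers which the simplifier can treat.\<close>

lemma veech_pieces:
  assumes fin: "finite \<P>"
    and cover: "\<And>x y. pt x y \<in> L_polygon \<Longrightarrow> \<exists>(H, c)\<in>\<P>. pt x y \<in> piece H"
    and vert: "\<And>H c x y. (H, c) \<in> \<P> \<Longrightarrow> pt x y \<in> piece H \<Longrightarrow>
      pt (a11 * x + a12 * y) (a21 * x + a22 * y) + c \<in> L_vertices \<longleftrightarrow> pt x y \<in> L_vertices"
    and overlap: "\<And>H c K d x y. (H, c) \<in> \<P> \<Longrightarrow> (K, d) \<in> \<P> \<Longrightarrow> pt x y \<in> piece H \<Longrightarrow> pt x y \<in> piece K \<Longrightarrow>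
      (pt (a11 * x + a12 * y) (a21 * x + a22 * y) + c, pt (a11 * x + a12 * y) (a21 * x + a22 * y) + d) \<in> L_equiv"
    and glue: "\<And>x y x' y'. (pt x y, pt x' y') \<in> side_gluing \<Longrightarrow>
      \<exists>(H, c)\<in>\<P>. \<exists>(K, d)\<in>\<P>. pt x y \<in> piece H \<and> pt x' y' \<in> piece K \<and>
        (pt (a11 * x + a12 * y) (a21 * x + a22 * y) + c, pt (a11 * x' + a12 * y') (a21 * x' + a22 * y') + d) \<in> L_equiv"
  shows "veech (\<lambda>v. pt (a11 * v $ 1 + a12 * v $ 2) (a21 * v $ 1 + a22 * v $ 2))"
proof -
  note c = pt_components[symmetric]
  show ?thesis
  proof (rule veech_piecewise[OF linear_pt, of "map_prod piece id ` \<P>"])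
    show "\<exists>P c. (P, c) \<in> map_prod piece id ` \<P> \<and> p \<in> P" if "p \<in> L_polygon" for p
      using cover[of "p $ 1" "p $ 2"] that unfolding c by force
    show "pt (a11 * p $ 1 + a12 * p $ 2) (a21 * p $ 1 + a22 * p $ 2) + d \<in> L_vertices \<longleftrightarrow> p \<in> L_vertices"
      if "(P, d) \<in> map_prod piece id ` \<P>" "p \<in> P" for P d p
      using vert[of _ d "p $ 1" "p $ 2"] that unfolding c by auto
    show "(pt (a11 * p $ 1 + a12 * p $ 2) (a21 * p $ 1 + a22 * p $ 2) + d,
        pt (a11 * p $ 1 + a12 * p $ 2) (a21 * p $ 1 + a22 * p $ 2) + e) \<in> L_equiv"
      if "(P, d) \<in> map_prod piece id ` \<P>" "(Q, e) \<in> map_prod piece id ` \<P>" "p \<in> P" "p \<in> Q" for P d Q e p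
      using overlap[of _ d _ e "p $ 1" "p $ 2"] that unfolding c by auto
    show "\<exists>P c Q d. (P, c) \<in> map_prod piece id ` \<P> \<and> (Q, d) \<in> map_prod piece id ` \<P> \<and> p \<in> P \<and> q \<in> Q \<and>
        (pt (a11 * p $ 1 + a12 * p $ 2) (a21 * p $ 1 + a22 * p $ 2) + c,
         pt (a11 * q $ 1 + a12 * q $ 2) (a21 * q $ 1 + a22 * q $ 2) + d) \<in> L_equiv"
      if "(p, q) \<in> side_gluing" for p q
      using glue[of "p $ 1" "p $ 2" "q $ 1" "q $ 2"] that unfolding c by force
  qed (use fin closed_convex_piece in auto)
qed

lemma pt_add: "pt a b + pt c d = pt (a + c) (b + d)"
  by (simp add: vec_eq_iff forall_2)

lemma phi_mult: "phi * (phi * x) = phi * x + x"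
  using phi_square by (metis distrib_right mult.assoc mult_1)

lemma pt_in_L_vertices_iff:
  "pt x y \<in> L_vertices \<longleftrightarrow>
     x = 0 \<and> (y = 0 \<or> y = 1 \<or> y = phi) \<or> x = 1 \<and> (y = 0 \<or> y = 1 \<or> y = phi) \<or> x = phi \<and> (y = 0 \<or> y = 1)"
  by (auto simp: in_L_vertices_iff)

lemma L_equiv_gluingI:
  "(p, q) \<in> side_gluing \<Longrightarrow> (p, q) \<in> L_equiv"
  "(q, p) \<in> side_gluing \<Longrightarrow> (p, q) \<in> L_equiv"
  using side_gluing_polygon by (auto simp: L_equiv_iff)

text \<open>Reduces the sixteen pairs of pieces of the shear to the four diagonal ones and six
  others.\<close>

lemma symmetric_on_four:
  assumes "\<And>a b. R a b \<Longrightarrow> R b a" "R p p" "R q q" "R r r" "R s s"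
    "R p q" "R p r" "R p s" "R q r" "R q s" "R r s"
  shows "\<forall>a\<in>{p, q, r, s}. \<forall>b\<in>{p, q, r, s}. R a b"
  using assms by blast

section \<open>The generators: swap, reflection and shear\<close>

text \<open>The polygon and its gluings are symmetric in the diagonal, so the swap acts without
  translation; the pieces are the two rectangles that form the polygon.\<close>

lemma veech_swap: "veech (\<lambda>v. pt (v $ 2) (v $ 1))"
proof -
  let ?\<P> = "{({(-1,0,0), (0,-1,0), (1,0,phi), (0,1,1)}, pt 0 0), ({(-1,0,0), (0,-1,0), (1,0,1), (0,1,phi)}, pt 0 0)}"
  have "veech (\<lambda>v. pt (0 * v $ 1 + 1 * v $ 2) (1 * v $ 1 + 0 * v $ 2))"
  proof (rule veech_pieces[of ?\<P>])
    show "\<exists>(H, c)\<in>?\<P>. pt x y \<in> piece H" if "pt x y \<in> L_polygon" for x y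
      using that by (auto simp: piece_def in_L_polygon_iff)
    show "pt (0 * x + 1 * y) (1 * x + 0 * y) + c \<in> L_vertices \<longleftrightarrow> pt x y \<in> L_vertices"
      if "(H, c) \<in> ?\<P>" for H c x y
      using that by (auto simp: pt_add pt_in_L_vertices_iff)
    show "(pt (0 * x + 1 * y) (1 * x + 0 * y) + c, pt (0 * x + 1 * y) (1 * x + 0 * y) + d) \<in> L_equiv"
      if "(H, c) \<in> ?\<P>" "(K, d) \<in> ?\<P>" "pt x y \<in> piece H" for H c K d x y
      using that phi_bounds by (auto simp: pt_add piece_def in_L_polygon_iff intro!: L_equiv_refl)
    fix x y x' y'
    assume g: "(pt x y, pt x' y') \<in> side_gluing"
    then have "(pt y x, pt y' x') \<in> side_gluing"
      by (auto simp: side_gluing_iff)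
    moreover have "\<exists>(H, c)\<in>?\<P>. pt x y \<in> piece H \<and> c = pt 0 0" "\<exists>(H, c)\<in>?\<P>. pt x' y' \<in> piece H \<and> c = pt 0 0"
      using side_gluing_polygon[OF g] by (auto simp: piece_def in_L_polygon_iff)
    ultimately show "\<exists>(H, c)\<in>?\<P>. \<exists>(K, d)\<in>?\<P>. pt x y \<in> piece H \<and> pt x' y' \<in> piece K \<and>
        (pt (0 * x + 1 * y) (1 * x + 0 * y) + c, pt (0 * x' + 1 * y') (1 * x' + 0 * y') + d) \<in> L_equiv"
      by (fastforce simp: pt_add intro: L_equiv_gluingI)
  qed auto
  then show ?thesis by simp
qed

text \<open>The surface consists of two vertical cylinders, over \<open>[0,1]\<close> and
  \<open>[1,phi]\<close>. Each is reflected in its own midline, x going to 1 - x and to phi + 1 - x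
  respectively.\<close>

lemma veech_reflect: "veech (\<lambda>v. pt (- v $ 1) (v $ 2))"
proof -
  let ?H1 = "{(-1,0,0), (0,-1,0), (1,0,1), (0,1,phi)} :: (real \<times> real \<times> real) set"
  let ?H2 = "{(-1,0,-1), (0,-1,0), (1,0,phi), (0,1,1)} :: (real \<times> real \<times> real) set"
  let ?\<P> = "{(?H1, pt 1 0), (?H2, pt (phi + 1) 0)}"
  have "veech (\<lambda>v. pt ((-1) * v $ 1 + 0 * v $ 2) (0 * v $ 1 + 1 * v $ 2))"
  proof (rule veech_pieces[of ?\<P>])
    show "\<exists>(H, c)\<in>?\<P>. pt x y \<in> piece H" if "pt x y \<in> L_polygon" for x y
      using that by (auto simp: piece_def in_L_polygon_iff)
    show "pt ((-1) * x + 0 * y) (0 * x + 1 * y) + c \<in> L_vertices \<longleftrightarrow> pt x y \<in> L_vertices"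
      if "(H, c) \<in> ?\<P>" "pt x y \<in> piece H" for H c x y
      using that phi_bounds by (auto simp: pt_add pt_in_L_vertices_iff piece_def)
    show "(pt ((-1) * x + 0 * y) (0 * x + 1 * y) + c, pt ((-1) * x + 0 * y) (0 * x + 1 * y) + d) \<in> L_equiv"
      if "(H, c) \<in> ?\<P>" "(K, d) \<in> ?\<P>" "pt x y \<in> piece H" "pt x y \<in> piece K" for H c K d x y
    proof -
      \<comment> \<open>On the common edge x = 1 the two formulas give 0 and \<open>phi\<close>,
        which are glued.\<close>
      have "(pt 0 y, pt phi y) \<in> L_equiv" "(pt phi y, pt 0 y) \<in> L_equiv" if "x = 1" "0 \<le> y" "y \<le> 1"
        using that L_equiv_gluingI[of "pt phi y" "pt 0 y"] L_equiv_sym by (auto simp: side_gluing_iff)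
      then show ?thesis
        using that phi_bounds by (auto simp: pt_add piece_def in_L_polygon_iff intro!: L_equiv_refl)
    qed
    fix x y x' y'
    assume "(pt x y, pt x' y') \<in> side_gluing"
    then consider "x = phi" "x' = 0" "y' = y" "0 \<le> y" "y \<le> 1" | "x = 1" "x' = 0" "y' = y" "1 \<le> y" "y \<le> phi"
      | "y = 1" "y' = 0" "x' = x" "1 \<le> x" "x \<le> phi" | "y = phi" "y' = 0" "x' = x" "0 \<le> x" "x \<le> 1"
      by (auto simp: side_gluing_iff)
    then show "\<exists>(H, c)\<in>?\<P>. \<exists>(K, d)\<in>?\<P>. pt x y \<in> piece H \<and> pt x' y' \<in> piece K \<and>
        (pt ((-1) * x + 0 * y) (0 * x + 1 * y) + c, pt ((-1) * x' + 0 * y') (0 * x' + 1 * y') + d) \<in> L_equiv"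
    proof cases
      case 1
      then show ?thesis using phi_bounds
        by (intro bexI[of _ "(?H2, pt (phi + 1) 0)"] bexI[of _ "(?H1, pt 1 0)"])
          (auto simp: piece_def pt_add in_L_polygon_iff intro!: L_equiv_refl)
    next
      case 2
      then show ?thesis using phi_bounds
        by (intro bexI[of _ "(?H1, pt 1 0)"])
          (auto simp: piece_def pt_add side_gluing_iff intro!: L_equiv_gluingI(2))
    next
      case 3
      then show ?thesis using phi_bounds
        by (intro bexI[of _ "(?H2, pt (phi + 1) 0)"])
          (auto simp: piece_def pt_add side_gluing_iff intro!: L_equiv_gluingI(1))
    next
      case 4
      then show ?thesis using phi_bounds
        by (intro bexI[of _ "(?H1, pt 1 0)"])
          (auto simp: piece_def pt_add side_gluing_iff intro!: L_equiv_gluingI(1))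
    qed
  qed auto
  then show ?thesis by simp
qed

text \<open>The horizontal cylinders have width \<open>phi\<close> and height 1, and width 1 and
  height \<open>phi - 1\<close>. Both ratios are \<open>phi\<close>, so the shear twists each
  cylinder exactly once. Each rectangle is cut along the diagonal that becomes vertical, and the far
  triangle is moved back by the width; the upper pieces also undo the displacement
  \<open>phi\<close> of their base.\<close>

lemma veech_shear: "veech (\<lambda>v. pt (v $ 1 + phi * v $ 2) (v $ 2))"
proof -
  let ?H1 = "{(-1,0,0), (0,-1,0), (1,phi,phi)} :: (real \<times> real \<times> real) set"
  let ?H2 = "{(1,0,phi), (0,1,1), (-1,-phi,-phi)} :: (real \<times> real \<times> real) set"
  let ?H3 = "{(-1,0,0), (0,-1,-1), (1,phi,phi+1)} :: (real \<times> real \<times> real) set"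
  let ?H4 = "{(1,0,1), (0,1,phi), (-1,-phi,-phi-1)} :: (real \<times> real \<times> real) set"
  let ?\<P> = "{(?H1, pt 0 0), (?H2, pt (-phi) 0), (?H3, pt (-phi) 0), (?H4, pt (-phi-1) 0)}"
  have phi_le: "phi * x \<le> phi * y \<longleftrightarrow> x \<le> y" for x y
    using phi_bounds by (simp add: mult_le_cancel_left)
  have "veech (\<lambda>v. pt (1 * v $ 1 + phi * v $ 2) (0 * v $ 1 + 1 * v $ 2))"
  proof (rule veech_pieces[of ?\<P>])
    show "\<exists>(H, c)\<in>?\<P>. pt x y \<in> piece H" if "pt x y \<in> L_polygon" for x y
      using that by (auto simp: piece_def in_L_polygon_iff)
    show "pt (1 * x + phi * y) (0 * x + 1 * y) + c \<in> L_vertices \<longleftrightarrow> pt x y \<in> L_vertices"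
      if "(H, c) \<in> ?\<P>" "pt x y \<in> piece H" for H c x y
    proof -
      \<comment> \<open>Both sides require \<open>y\<close> to be 0, 1 or \<open>phi\<close>; at
        these heights \<open>phi * y\<close> is a constant and the claim is linear.\<close>
      have "y = 0 \<or> y = 1 \<or> y = phi \<or> (y \<noteq> 0 \<and> y \<noteq> 1 \<and> y \<noteq> phi)" by blast
      then show ?thesis
        using that phi_bounds phi_square
        by (elim disjE) (auto simp: pt_add pt_in_L_vertices_iff piece_def)
    qed
    show "(pt (1 * x + phi * y) (0 * x + 1 * y) + c, pt (1 * x + phi * y) (0 * x + 1 * y) + d) \<in> L_equiv"
      if "(H, c) \<in> ?\<P>" "(K, d) \<in> ?\<P>" "pt x y \<in> piece H" "pt x y \<in> piece K" for H c K d x y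
    proof -
      \<comment> \<open>With these facts linear arithmetic can treat \<open>phi * y\<close> as an
        independent unknown.\<close>
      have y: "0 \<le> phi * y \<longleftrightarrow> 0 \<le> y" "phi * y \<le> phi \<longleftrightarrow> y \<le> 1" "phi \<le> phi * y \<longleftrightarrow> 1 \<le> y"
        "phi * y \<le> phi + 1 \<longleftrightarrow> y \<le> phi"
        using phi_le[of 0 y] phi_le[of y 1] phi_le[of 1 y] phi_le[of y phi] phi_square by simp_all
      have g1: "(pt phi y, pt 0 y) \<in> L_equiv" if "0 \<le> y" "y \<le> 1"
        using that by (intro L_equiv_gluingI(1)) (simp add: side_gluing_iff)
      have g2: "(pt 1 y, pt 0 y) \<in> L_equiv" if "1 \<le> y" "y \<le> phi"
        using that by (intro L_equiv_gluingI(1)) (simp add: side_gluing_iff)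
      have v: "(pt a 1, pt b 1) \<in> L_equiv" if "a \<in> {0, 1, phi}" "b \<in> {0, 1, phi}" for a b
        using that by (intro L_vertices_equiv) (auto simp: pt_in_L_vertices_iff)
      have pieces:
        "pt x y \<in> piece ?H1 \<longleftrightarrow> 0 \<le> x \<and> 0 \<le> y \<and> x + phi * y \<le> phi"
        "pt x y \<in> piece ?H2 \<longleftrightarrow> x \<le> phi \<and> y \<le> 1 \<and> phi \<le> x + phi * y"
        "pt x y \<in> piece ?H3 \<longleftrightarrow> 0 \<le> x \<and> 1 \<le> y \<and> x + phi * y \<le> phi + 1"
        "pt x y \<in> piece ?H4 \<longleftrightarrow> x \<le> 1 \<and> y \<le> phi \<and> phi + 1 \<le> x + phi * y"
        by (auto simp: piece_def)
      let ?E = "\<lambda>a b. (pt (x + phi * y + a) y, pt (x + phi * y + b) y) \<in> L_equiv"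
      have E11: "?E 0 0" if "pt x y \<in> piece ?H1"
      proof -
        note that = that[unfolded pieces]
        have "phi * y \<le> phi" "0 \<le> phi * y" "y \<le> 1"
          using that y phi_bounds by linarith+
        then show ?thesis using that phi_bounds by (intro L_equiv_refl) (simp add: in_L_polygon_iff)
      qed
      have E22: "?E (- phi) (- phi)" if "pt x y \<in> piece ?H2"
      proof -
        note that = that[unfolded pieces]
        have "0 \<le> y" "x + phi * y \<le> 2 * phi"
          using that y phi_bounds by linarith+
        then show ?thesis using that phi_bounds by (intro L_equiv_refl) (simp add: in_L_polygon_iff)
      qed
      have E33: "?E (- phi) (- phi)" if "pt x y \<in> piece ?H3"
      proof -
        note that = that[unfolded pieces]
        have "phi \<le> x + phi * y" "x + phi * y \<le> 2 * phi" "y \<le> phi"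
          using that y phi_bounds by linarith+
        then show ?thesis using that phi_bounds by (intro L_equiv_refl) (simp add: in_L_polygon_iff)
      qed
      have E44: "?E (- phi - 1) (- phi - 1)" if "pt x y \<in> piece ?H4"
      proof -
        note that = that[unfolded pieces]
        have "1 \<le> y" "x + phi * y \<le> phi + 2"
          using that y phi_bounds by linarith+
        then show ?thesis using that phi_bounds by (intro L_equiv_refl) (simp add: in_L_polygon_iff)
      qed
      have E12: "?E 0 (- phi)" if "pt x y \<in> piece ?H1" "pt x y \<in> piece ?H2"
      proof -
        have "x + phi * y = phi" "0 \<le> y" "y \<le> 1" using that unfolding pieces by auto
        then show ?thesis using g1 by simp
      qed
      \<comment> \<open>The triangles touch only in \<open>pt 0 1\<close>, and both images of this
        point are vertices.\<close>
      have E13: "?E 0 (- phi)" if "pt x y \<in> piece ?H1" "pt x y \<in> piece ?H3"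
      proof -
        have "x = 0" "y = 1" using that y unfolding pieces by linarith+
        then show ?thesis using v by simp
      qed
      have E14: "?E 0 (- phi - 1)" if "pt x y \<in> piece ?H1" "pt x y \<in> piece ?H4"
        using that unfolding pieces by linarith
      have E24: "?E (- phi) (- phi - 1)" if "pt x y \<in> piece ?H2" "pt x y \<in> piece ?H4"
      proof -
        have "x = 1" "y = 1" using that y unfolding pieces by linarith+
        then show ?thesis using v by simp
      qed
      have E34: "?E (- phi) (- phi - 1)" if "pt x y \<in> piece ?H3" "pt x y \<in> piece ?H4"
      proof -
        have "x + phi * y = phi + 1" "1 \<le> y" "y \<le> phi" using that unfolding pieces by auto
        then show ?thesis using g2 by simp
      qed
      define Q where "Q a b \<longleftrightarrow> (pt x y \<in> piece (fst a) \<longrightarrow> pt x y \<in> piece (fst b) \<longrightarrow>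
        (pt (x + phi * y) y + snd a, pt (x + phi * y) y + snd b) \<in> L_equiv)" for a b
      have QI: "Q (G, pt a 0) (G', pt b 0)" if "pt x y \<in> piece G \<Longrightarrow> pt x y \<in> piece G' \<Longrightarrow> ?E a b" for G G' a b
        using that unfolding Q_def by (simp add: pt_add)
      have "Q b a" if "Q a b" for a b using that L_equiv_sym by (auto simp: Q_def)
      moreover have "Q (?H1, pt 0 0) (?H1, pt 0 0)" by (rule QI) (rule E11)
      moreover have "Q (?H2, pt (-phi) 0) (?H2, pt (-phi) 0)" by (rule QI) (rule E22)
      moreover have "Q (?H3, pt (-phi) 0) (?H3, pt (-phi) 0)" by (rule QI) (rule E33)
      moreover have "Q (?H4, pt (-phi-1) 0) (?H4, pt (-phi-1) 0)" by (rule QI) (rule E44)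
      moreover have "Q (?H1, pt 0 0) (?H2, pt (-phi) 0)" by (rule QI) (rule E12)
      moreover have "Q (?H1, pt 0 0) (?H3, pt (-phi) 0)" by (rule QI) (rule E13)
      moreover have "Q (?H1, pt 0 0) (?H4, pt (-phi-1) 0)" by (rule QI) (rule E14)
      \<comment> \<open>Both pieces are moved by \<open>- phi\<close>, so it only matters that the
        image lies in the polygon, which \<open>E22\<close> says.\<close>
      moreover have "Q (?H2, pt (-phi) 0) (?H3, pt (-phi) 0)" by (rule QI) (rule E22)
      moreover have "Q (?H2, pt (-phi) 0) (?H4, pt (-phi-1) 0)" by (rule QI) (rule E24)
      moreover have "Q (?H3, pt (-phi) 0) (?H4, pt (-phi-1) 0)" by (rule QI) (rule E34)
      ultimately have "\<forall>a\<in>?\<P>. \<forall>b\<in>?\<P>. Q a b" by (rule symmetric_on_four)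
      then have "Q (H, c) (K, d)" by (rule bspec[OF bspec[OF _ that(1)] that(2)])
      then show ?thesis using that(3,4) unfolding Q_def fst_conv snd_conv by (simp only: mult_1 mult_zero_left add_0)
    qed
    fix x y x' y'
    assume "(pt x y, pt x' y') \<in> side_gluing"
    then consider "x = phi" "x' = 0" "y' = y" "0 \<le> y" "y \<le> 1" | "x = 1" "x' = 0" "y' = y" "1 \<le> y" "y \<le> phi"
      | "y = 1" "y' = 0" "x' = x" "1 \<le> x" "x \<le> phi" | "y = phi" "y' = 0" "x' = x" "0 \<le> x" "x \<le> 1"
      by (auto simp: side_gluing_iff)
    then show "\<exists>(H, c)\<in>?\<P>. \<exists>(K, d)\<in>?\<P>. pt x y \<in> piece H \<and> pt x' y' \<in> piece K \<and>
        (pt (1 * x + phi * y) (0 * x + 1 * y) + c, pt (1 * x' + phi * y') (0 * x' + 1 * y') + d) \<in> L_equiv"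
    proof cases
      case 1
      then show ?thesis using phi_bounds phi_le[of y 1]
        by (intro bexI[of _ "(?H2, pt (-phi) 0)"] bexI[of _ "(?H1, pt 0 0)"])
          (auto simp: piece_def pt_add in_L_polygon_iff intro!: L_equiv_refl)
    next
      case 2
      then show ?thesis using phi_bounds phi_le[of 1 y] phi_le[of y phi] phi_square
        by (intro bexI[of _ "(?H4, pt (-phi-1) 0)"] bexI[of _ "(?H3, pt (-phi) 0)"])
          (auto simp: piece_def pt_add in_L_polygon_iff intro!: L_equiv_refl)
    next
      case 3
      then show ?thesis using phi_bounds
        by (intro bexI[of _ "(?H2, pt (-phi) 0)"] bexI[of _ "(?H1, pt 0 0)"])
          (auto simp: piece_def pt_add side_gluing_iff intro!: L_equiv_gluingI(1))
    next
      case 4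
      then show ?thesis using phi_bounds phi_square
        by (intro bexI[of _ "(?H4, pt (-phi-1) 0)"] bexI[of _ "(?H1, pt 0 0)"])
          (auto simp: piece_def pt_add side_gluing_iff intro!: L_equiv_gluingI(1))
    qed
  qed auto
  then show ?thesis by simp
qed

section \<open>The matrices as products of the generators\<close>

lemma sigma_eq:
  "k < 4 \<Longrightarrow> sigma k *v v =
     (if k = 0 then pt (v $ 1 + phi * v $ 2) (v $ 2)
      else if k = 1 then pt (phi * v $ 1 + phi * v $ 2) (v $ 1 + phi * v $ 2)
      else if k = 2 then pt (phi * v $ 1 + v $ 2) (phi * v $ 1 + phi * v $ 2)
      else pt (v $ 1) (phi * v $ 1 + v $ 2))"
  using sigma_simps[of v] by (auto simp: numeral_eq_Suc less_Suc_eq)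

lemma less_4_cases:
  fixes k :: nat
  assumes "k < 4" obtains "k = 0" | "k = 1" | "k = 2" | "k = 3"
  using assms by linarith

lemma det_sigma: "k < 4 \<Longrightarrow> det (sigma k) = 1"
  using phi_square by (elim less_4_cases) (simp_all add: det_2 sigma_def)

lemma matrix_inv_mult_vec:
  fixes M :: "real^'n^'n"
  assumes "invertible M"
  shows "matrix_inv M *v (M *v v) = v" "M *v (matrix_inv M *v v) = v"
proof -
  have "M ** matrix_inv M = mat 1 \<and> matrix_inv M ** M = mat 1"
    using assms unfolding invertible_def matrix_inv_def by (rule someI_ex)
  then show "matrix_inv M *v (M *v v) = v" "M *v (matrix_inv M *v v) = v"
    by (simp_all add: matrix_vector_mul_assoc)
qed

lemma matrix_inv_sigma:
  assumes "k < 4"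
  shows "matrix_inv (sigma k) *v (sigma k *v v) = v" "sigma k *v (matrix_inv (sigma k) *v v) = v"
  using matrix_inv_mult_vec[of "sigma k"] det_sigma[OF assms] by (simp_all add: invertible_det_nz)

text \<open>\<open>J \<circ> R\<close> is a quarter turn, and \<open>sigma 1\<close> is this turn
  between two shears. Conjugation by the swap \<open>R\<close> turns \<open>sigma 0\<close> into
  \<open>sigma 3\<close> and \<open>sigma 1\<close> into \<open>sigma 2\<close>. The inverses
  reverse the products, with \<open>S'\<close> for \<open>S\<close>.\<close>

lemma veech_sigma:
  assumes "k < 4"
  shows "veech (\<lambda>v. sigma k *v v)" "veech (\<lambda>v. matrix_inv (sigma k) *v v)"
proof -
  define S where "S v = pt (v $ 1 + phi * v $ 2) (v $ 2)" for v :: "real^2"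
  define S' where "S' v = pt (v $ 1 - phi * v $ 2) (v $ 2)" for v :: "real^2"
  define R where "R v = pt (v $ 2) (v $ 1)" for v :: "real^2"
  define J where "J v = pt (- v $ 1) (v $ 2)" for v :: "real^2"
  have "veech S" "veech R" "veech J"
    unfolding S_def R_def J_def using veech_shear veech_swap veech_reflect by blast+
  have "J \<circ> S \<circ> J = S'" by (simp add: fun_eq_iff J_def S_def S'_def)
  then have "veech S'" using veech_comp \<open>veech S\<close> \<open>veech J\<close> by metis
  note comp = veech_comp \<open>veech S\<close> \<open>veech R\<close> \<open>veech J\<close> \<open>veech S'\<close>
  have "\<exists>f g. (\<lambda>v. sigma k *v v) = f \<and> (\<forall>v. sigma k *v g v = v) \<and> veech f \<and> veech g"
    using assms
  proof (cases rule: less_4_cases)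
    case 1
    then have "(\<lambda>v. sigma k *v v) = S" "\<forall>v. sigma k *v S' v = v"
      by (simp_all add: fun_eq_iff sigma_eq S_def S'_def vec_eq_iff forall_2)
    moreover have "veech (S)" "veech (S')" by (intro comp)+
    ultimately show ?thesis by blast
  next
    case 2
    then have "(\<lambda>v. sigma k *v v) = S \<circ> (J \<circ> (R \<circ> S))" "\<forall>v. sigma k *v (S' \<circ> (R \<circ> (J \<circ> S'))) v = v"
      by (simp_all add: fun_eq_iff sigma_eq S_def S'_def R_def J_def vec_eq_iff forall_2 distrib_left right_diff_distrib phi_mult)
    moreover have "veech (S \<circ> (J \<circ> (R \<circ> S)))" "veech (S' \<circ> (R \<circ> (J \<circ> S')))" by (intro comp)+
    ultimately show ?thesis by blast
  next
    case 3
    then have "(\<lambda>v. sigma k *v v) = R \<circ> (S \<circ> (J \<circ> (R \<circ> (S \<circ> R))))"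
      "\<forall>v. sigma k *v (R \<circ> (S' \<circ> (R \<circ> (J \<circ> (S' \<circ> R))))) v = v"
      by (simp_all add: fun_eq_iff sigma_eq S_def S'_def R_def J_def vec_eq_iff forall_2 distrib_left right_diff_distrib phi_mult)
    moreover have "veech (R \<circ> (S \<circ> (J \<circ> (R \<circ> (S \<circ> R)))))" "veech (R \<circ> (S' \<circ> (R \<circ> (J \<circ> (S' \<circ> R)))))" by (intro comp)+
    ultimately show ?thesis by blast
  next
    case 4
    then have "(\<lambda>v. sigma k *v v) = R \<circ> (S \<circ> R)" "\<forall>v. sigma k *v (R \<circ> (S' \<circ> R)) v = v"
      by (simp_all add: fun_eq_iff sigma_eq S_def S'_def R_def vec_eq_iff forall_2)
    moreover have "veech (R \<circ> (S \<circ> R))" "veech (R \<circ> (S' \<circ> R))" by (intro comp)+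
    ultimately show ?thesis by blast
  qed
  then obtain f g where fg: "(\<lambda>v. sigma k *v v) = f" "\<forall>v. sigma k *v g v = v" "veech f" "veech g" by blast
  \<comment> \<open>As \<open>sigma k\<close> is invertible, its right inverse \<open>g\<close> is
    the inverse.\<close>
  have "matrix_inv (sigma k) *v v = g v" for v
    using matrix_inv_sigma(1)[OF assms, of "g v"] fg(2) by simp
  then have "(\<lambda>v. matrix_inv (sigma k) *v v) = g" by (rule ext)
  then show "veech (\<lambda>v. sigma k *v v)" "veech (\<lambda>v. matrix_inv (sigma k) *v v)" using fg by simp_all
qed

section \<open>Transport of holonomies and saddle connections\<close>

text \<open>The displacement of a closed trajectory over a period \<open>T\<close>, not necessarily
  the least one. It records a length besides the direction, and so can have coordinates of
  arithmetic type.\<close>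

definition holonomy :: "real^2 \<Rightarrow> bool" where
  "holonomy u \<longleftrightarrow> (\<exists>w \<gamma> T. T > 0 \<and> u = T *\<^sub>R w \<and> straight_path UNIV w \<gamma> \<and>
     (\<forall>t. \<not> singular (\<gamma> t)) \<and> (\<forall>t. \<gamma> (t + T) = \<gamma> t))"

lemma holonomy_veech:
  assumes "veech A" "linear A" "holonomy u"
  shows "holonomy (A u)"
proof -
  obtain w \<gamma> T where h: "T > 0" "u = T *\<^sub>R w" "straight_path UNIV w \<gamma>"
    "\<forall>t. \<not> singular (\<gamma> t)" "\<forall>t. \<gamma> (t + T) = \<gamma> t"
    using assms(3) unfolding holonomy_def by blast
  obtain F where F: "affine_map_on_L A F" using assms(1) by (auto simp: veech_def)
  have "A u = T *\<^sub>R A w" using h assms(2) by (simp add: linear_cmul)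
  moreover have "straight_path UNIV (A w) (F \<circ> \<gamma>)" using F h by (simp add: affine_map_on_L_def)
  moreover have "\<forall>t. \<not> singular ((F \<circ> \<gamma>) t)"
    using F h straight_path_golden_L[OF h(3)] by (simp add: affine_map_on_L_def)
  moreover have "\<forall>t. (F \<circ> \<gamma>) (t + T) = (F \<circ> \<gamma>) t" using h by simp
  ultimately show ?thesis using h(1) unfolding holonomy_def by blast
qed

lemma periodic_direction_holonomy:
  assumes "periodic_direction v"
  shows "\<exists>c>0. holonomy (c *\<^sub>R v)"
proof -
  obtain w \<gamma> c T where "c > 0" "w = c *\<^sub>R v" "T > 0" "straight_path UNIV w \<gamma>"
    "\<forall>t. \<not> singular (\<gamma> t)" "\<forall>t. \<gamma> (t + T) = \<gamma> t"
    using assms unfolding periodic_direction_def same_direction_def periodic_trajectory_def by blast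
  then show ?thesis
    by (intro exI[of _ "T * c"]) (auto simp: holonomy_def intro!: exI[of _ w] exI[of _ \<gamma>] exI[of _ T])
qed

lemma saddle_connection_veech:
  assumes "veech A" "saddle_connection_vector w" "A w \<noteq> 0"
  shows "saddle_connection_vector (A w)"
proof -
  obtain \<gamma> where h: "straight_path {0..1} w \<gamma>" "singular (\<gamma> 0)" "singular (\<gamma> 1)"
    "\<forall>t\<in>{0<..<1}. \<not> singular (\<gamma> t)"
    using assms(2) unfolding saddle_connection_vector_def by blast
  obtain F where F: "affine_map_on_L A F" using assms(1) by (auto simp: veech_def)
  then have "straight_path {0..1} (A w) (F \<circ> \<gamma>)" using h by (simp add: affine_map_on_L_def)
  moreover have "singular ((F \<circ> \<gamma>) t) \<longleftrightarrow> singular (\<gamma> t)" if "t \<in> {0..1}" for t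
    using F straight_path_golden_L[OF h(1) that] by (simp add: affine_map_on_L_def)
  ultimately show ?thesis using h assms(3) unfolding saddle_connection_vector_def
    by (intro conjI exI[of _ "F \<circ> \<gamma>"]) auto
qed

section \<open>Saddle connections\<close>

text \<open>Vectors rather than lengths, because linear maps act on these.\<close>

definition saddle_vectors :: "real^2 \<Rightarrow> (real^2) set" where
  "saddle_vectors v = {w. saddle_connection_vector w \<and> same_direction v w}"

lemma sigma_vec_nonzero: "k < 4 \<Longrightarrow> v \<noteq> 0 \<Longrightarrow> sigma k *v v \<noteq> 0"
  using matrix_inv_sigma(1)[of k v] by force

lemma sigma_scaleR: "(sigma k :: real^2^2) *v (c *\<^sub>R v) = c *\<^sub>R (sigma k *v v)"
  by (rule matrix_vector_mult_scaleR)

text \<open>The automorphism with derivative \<open>sigma k\<close> gives one inclusion, the one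
  with the inverse derivative the other.\<close>

lemma saddle_vectors_sigma:
  assumes k: "k < 4"
  shows "saddle_vectors (sigma k *v v) = (\<lambda>w. sigma k *v w) ` saddle_vectors v"
proof -
  have "sigma k *v w \<in> saddle_vectors (sigma k *v v)" if "w \<in> saddle_vectors v" for w
    using that saddle_connection_veech[OF veech_sigma(1)[OF k], of w] sigma_vec_nonzero[OF k]
    by (auto simp: saddle_vectors_def same_direction_def saddle_connection_vector_def sigma_scaleR)
  moreover have "w \<in> (\<lambda>w. sigma k *v w) ` saddle_vectors v" if w: "w \<in> saddle_vectors (sigma k *v v)" for w
  proof -
    obtain c where c: "c > 0" "w = c *\<^sub>R (sigma k *v v)" "saddle_connection_vector w" "sigma k *v v \<noteq> 0"
      using w unfolding saddle_vectors_def same_direction_def by blast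
    have v0: "v \<noteq> 0" using c(4) by auto
    have "matrix_inv (sigma k) *v w = c *\<^sub>R v"
      using c(2) matrix_inv_sigma(1)[OF k, of "c *\<^sub>R v"] by (simp add: sigma_scaleR)
    then have "saddle_connection_vector (c *\<^sub>R v)"
      using saddle_connection_veech[OF veech_sigma(2)[OF k] c(3)] c(1) v0 by simp
    then have "c *\<^sub>R v \<in> saddle_vectors v"
      using c(1) v0 by (auto simp: saddle_vectors_def same_direction_def)
    then show ?thesis unfolding c(2) sigma_scaleR[symmetric] by (rule imageI)
  qed
  ultimately show ?thesis by blast
qed

lemma saddle_vectors_scaleR:
  assumes "l > 0"
  shows "saddle_vectors (l *\<^sub>R v) = saddle_vectors v"
proof -
  have "(\<exists>c>0. w = c *\<^sub>R l *\<^sub>R v) \<longleftrightarrow> (\<exists>c>0. w = c *\<^sub>R v)" for w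
  proof
    assume "\<exists>c>0. w = c *\<^sub>R v"
    then obtain c where "c > 0" "w = c *\<^sub>R v" by blast
    then show "\<exists>c>0. w = c *\<^sub>R l *\<^sub>R v" using assms by (intro exI[of _ "c / l"]) simp
  next
    assume "\<exists>c>0. w = c *\<^sub>R l *\<^sub>R v"
    then obtain c where "c > 0" "w = c *\<^sub>R l *\<^sub>R v" by blast
    then show "\<exists>c>0. w = c *\<^sub>R v" using assms by (intro exI[of _ "c * l"]) simp
  qed
  then show ?thesis using assms by (simp add: saddle_vectors_def same_direction_def)
qed

section \<open>Saddle connections in the horizontal direction\<close>

text \<open>Inside the polygon the path never changes its representative, so the point of the
  segment itself serves for both germs at each time.\<close>

lemma segment_saddle_connection:
  assumes "w \<noteq> 0" "\<And>t. t \<in> {0..1} \<Longrightarrow> p + t *\<^sub>R w \<in> L_polygon" "p \<in> L_vertices" "p + w \<in> L_vertices"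
    "\<And>t. t \<in> {0<..<1} \<Longrightarrow> p + t *\<^sub>R w \<notin> L_vertices"
  shows "saddle_connection_vector w"
proof -
  define \<gamma> where "\<gamma> t = L_equiv `` {p + t *\<^sub>R w}" for t
  have in_\<gamma>: "p + t *\<^sub>R w \<in> \<gamma> t" if "t \<in> {0..1}" for t
    using assms(2)[OF that] by (simp add: \<gamma>_def L_equiv_refl)
  have gl: "\<gamma> t \<in> golden_L" if "t \<in> {0..1}" for t
    using assms(2)[OF that] by (simp add: \<gamma>_def golden_L_classI)
  have sing: "singular (\<gamma> t) \<longleftrightarrow> p + t *\<^sub>R w \<in> L_vertices" if "t \<in> {0..1}" for t
    using singular_iff gl in_\<gamma> that by blast
  have "straight_path {0..1} w \<gamma>"
    unfolding straight_path_iff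
  proof (intro conjI ballI)
    fix t \<epsilon> :: real assume t: "t \<in> {0..1}"
    have "p + t *\<^sub>R w + s *\<^sub>R \<epsilon> *\<^sub>R w \<in> \<gamma> (t + \<epsilon> * s)" if "t + \<epsilon> * s \<in> {0..1}" for s
      using in_\<gamma>[OF that] by (simp add: algebra_simps)
    then show "\<exists>e>0. \<exists>p\<in>\<gamma> t. \<forall>s\<in>{0..e}. t + \<epsilon> * s \<in> {0..1} \<longrightarrow> p + s *\<^sub>R \<epsilon> *\<^sub>R w \<in> \<gamma> (t + \<epsilon> * s)"
      using in_\<gamma>[OF t] by (intro exI[of _ 1] conjI bexI[of _ "p + t *\<^sub>R w"]) auto
  qed (rule gl)
  then show ?thesis using assms sing unfolding saddle_connection_vector_def by (intro conjI exI[of _ \<gamma>]) auto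
qed

lemma inverse_phi: "1 / phi = phi - 1"
  using phi_square phi_bounds by (simp add: field_simps)

text \<open>The vertical sides meet these heights only in vertices, and the gluings of the
  horizontal sides keep the first coordinate.\<close>

lemma L_equiv_horizontal:
  assumes "(p, q) \<in> L_equiv" "p \<notin> L_vertices" "p $ 2 \<in> {0, 1, phi}"
  shows "q $ 2 \<in> {0, 1, phi}" "q $ 1 = p $ 1"
proof -
  have "q $ 2 \<in> {0, 1, phi} \<and> q $ 1 = p $ 1"
    using assms unfolding L_equiv_iff side_gluing_iff in_L_vertices_iff
    using phi_bounds by (elim conjE disjE) auto
  then show "q $ 2 \<in> {0, 1, phi}" "q $ 1 = p $ 1" by auto
qed

text \<open>On horizontal saddle connections the first coordinate is well defined away from the
  singularity, so it grows with constant speed \<open>c\<close> along the path.\<close>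

lemma horizontal_saddle_connections:
  assumes c: "c > 0" and sc: "saddle_connection_vector (pt c 0)"
  shows "c = 1 \<or> c = 1 / phi"
proof -
  let ?w = "pt c 0"
  let ?Y = "{0, 1, phi}"
  obtain \<gamma> where \<gamma>: "straight_path {0..1} ?w \<gamma>" "singular (\<gamma> 0)" "singular (\<gamma> 1)"
    and ns: "\<And>t. t \<in> {0<..<1} \<Longrightarrow> \<not> singular (\<gamma> t)"
    using sc unfolding saddle_connection_vector_def by blast
  note gl = straight_path_golden_L[OF \<gamma>(1)]
  have nv: "p \<notin> L_vertices" if "t \<in> {0<..<1}" "p \<in> \<gamma> t" for p t
    using ns[OF that(1)] singular_iff[OF gl that(2)] that(1) by simp
  have fwd: "\<exists>e>0. \<exists>p\<in>\<gamma> t. \<forall>s\<in>{0..e}. t + s \<in> {0..1} \<longrightarrow> p + s *\<^sub>R ?w \<in> \<gamma> (t + s)" if "t \<in> {0..1}" for t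
    using \<gamma>(1) that unfolding straight_path_def by blast
  have bwd: "\<exists>e>0. \<exists>p\<in>\<gamma> t. \<forall>s\<in>{0..e}. t - s \<in> {0..1} \<longrightarrow> p - s *\<^sub>R ?w \<in> \<gamma> (t - s)" if "t \<in> {0..1}" for t
    using \<gamma>(1) that unfolding straight_path_def by blast
  \<comment> \<open>The guards exclude the end times, where the path is singular and its coordinates
    depend on the representative.\<close>
  define P where "P a b \<longleftrightarrow> (0 < a \<longrightarrow> b < 1 \<longrightarrow> (\<forall>p\<in>\<gamma> a. \<forall>q\<in>\<gamma> b. p $ 2 \<in> ?Y \<longrightarrow> q $ 2 \<in> ?Y \<and> q $ 1 = p $ 1 + c * (b - a)))" for a b
  \<comment> \<open>By bisection it suffices that the property is additive and holds on short
    intervals around each time.\<close>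
  have flow: "P a b" if ab: "0 < a" "a \<le> b" "b < 1" for a b
    using ab(2)
  proof (induction rule: Bolzano)
    case (trans r s t)
    show ?case
      unfolding P_def
    proof (intro impI ballI)
      fix p q' assume *: "0 < r" "t < 1" "p \<in> \<gamma> r" "q' \<in> \<gamma> t" "p $ 2 \<in> ?Y"
      obtain q where "q \<in> \<gamma> s" using golden_L_nonempty[OF gl[of s]] trans * by auto
      then show "q' $ 2 \<in> ?Y \<and> q' $ 1 = p $ 1 + c * (t - r)"
      proof -
        assume q: "q \<in> \<gamma> s"
        have "0 < s" "s < 1" using trans * by auto
        then have "q $ 2 \<in> ?Y" "q $ 1 = p $ 1 + c * (s - r)"
          using trans(1)[unfolded P_def] * q by blast+
        moreover from this have "q' $ 2 \<in> ?Y" "q' $ 1 = q $ 1 + c * (t - s)"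
          using trans(2)[unfolded P_def] * q \<open>0 < s\<close> by blast+
        ultimately show ?thesis by (simp add: algebra_simps)
      qed
    qed
  next
    case (local x)
    then have x: "x \<in> {0<..<1}" using ab by auto
    obtain e p where p: "e > 0" "p \<in> \<gamma> x" "\<forall>s\<in>{0..e}. x + s \<in> {0..1} \<longrightarrow> p + s *\<^sub>R ?w \<in> \<gamma> (x + s)"
      using fwd[of x] x by auto
    obtain d q where q: "d > 0" "q \<in> \<gamma> x" "\<forall>s\<in>{0..d}. x - s \<in> {0..1} \<longrightarrow> q - s *\<^sub>R ?w \<in> \<gamma> (x - s)"
      using bwd[of x] x by auto
    \<comment> \<open>The path is read off from \<open>q\<close> before the time \<open>x\<close>
      and from \<open>p\<close> after it; the equivalences at the times \<open>r\<close>,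
      \<open>x\<close> and \<open>t\<close> carry height and first coordinate from \<open>p'\<close>
      to \<open>q'\<close>.\<close>
    have "P r t" if rt: "r \<le> x" "x \<le> t" "t - r < Min {d, e, x, 1 - x}" for r t
      unfolding P_def
    proof (intro ballI impI)
      fix p' q' assume "0 < r" "t < 1" and p': "p' \<in> \<gamma> r" "p' $ 2 \<in> ?Y" and q': "q' \<in> \<gamma> t"
      have r: "r \<in> {0<..<1}" "t \<in> {0<..<1}" using rt \<open>0 < r\<close> \<open>t < 1\<close> by auto
      have "q - (x - r) *\<^sub>R ?w \<in> \<gamma> r" using q(3)[rule_format, of "x - r"] rt r by simp
      then have "(p', q - (x - r) *\<^sub>R ?w) \<in> L_equiv" using golden_L_equiv[OF gl[of r]] p'(1) r by simp
      from L_equiv_horizontal[OF this nv[OF r(1) p'(1)] p'(2)]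
      have 1: "q $ 2 \<in> ?Y" "q $ 1 = p' $ 1 + c * (x - r)" by (auto simp: algebra_simps)
      have "(q, p) \<in> L_equiv" using golden_L_equiv[OF gl[of x]] p(2) q(2) x by simp
      from L_equiv_horizontal[OF this nv[OF x q(2)] 1(1)]
      have 2: "(p + (t - x) *\<^sub>R ?w) $ 2 \<in> ?Y" "p $ 1 = q $ 1" by auto
      have 3: "p + (t - x) *\<^sub>R ?w \<in> \<gamma> t" using p(3)[rule_format, of "t - x"] rt r by simp
      then have "(p + (t - x) *\<^sub>R ?w, q') \<in> L_equiv" using golden_L_equiv[OF gl[of t]] q' r by simp
      from L_equiv_horizontal[OF this nv[OF r(2) 3] 2(1)]
      show "q' $ 2 \<in> ?Y \<and> q' $ 1 = p' $ 1 + c * (t - r)" using 1 2 by (auto simp: algebra_simps)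
    qed
    moreover have "0 < Min {d, e, x, 1 - x}" using x p(1) q(1) by simp
    ultimately show ?case by blast
  qed
  obtain e p where p: "e > 0" "p \<in> \<gamma> 0" "\<forall>s\<in>{0..e}. 0 + s \<in> {0..1} \<longrightarrow> p + s *\<^sub>R ?w \<in> \<gamma> (0 + s)"
    using fwd[of 0] by auto
  obtain d q where q: "d > 0" "q \<in> \<gamma> 1" "\<forall>s\<in>{0..d}. 1 - s \<in> {0..1} \<longrightarrow> q - s *\<^sub>R ?w \<in> \<gamma> (1 - s)"
    using bwd[of 1] by auto
  have vert: "p \<in> L_vertices" "q \<in> L_vertices"
    using singular_iff gl p(2) q(2) \<gamma>(2,3) by (auto simp: singular_def)
  have pos: "(r $ 2 \<in> ?Y \<and> r $ 1 = p $ 1 + c * t)" if t: "t \<in> {0<..<1}" "r \<in> \<gamma> t" for r t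
  proof -
    \<comment> \<open>\<open>flow\<close> needs a positive starting time, so the position just after
      the start is taken from the germ at the vertex \<open>p\<close>.\<close>
    define s where "s = min e t"
    have s: "s \<in> {0<..<1}" "s \<le> t" "s \<le> e" using p(1) t by (auto simp: s_def)
    have "p + s *\<^sub>R ?w \<in> \<gamma> s" using p(3)[rule_format, of s] s by simp
    moreover have "(p + s *\<^sub>R ?w) $ 2 \<in> ?Y" using vert(1) by (auto simp: in_L_vertices_iff)
    ultimately show ?thesis
      using flow[of s t] s t unfolding P_def by (fastforce simp: algebra_simps)
  qed
  have "q $ 1 = p $ 1 + c"
  proof -
    \<comment> \<open>The bound 1/2 keeps \<open>1 - s\<close> an interior time, where
      \<open>pos\<close> applies.\<close>
    define s where "s = min d (1/2)"
    have s: "s \<in> {0<..<1}" "s \<le> d" using q(1) by (auto simp: s_def)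
    have "q - s *\<^sub>R ?w \<in> \<gamma> (1 - s)" using q(3)[rule_format, of s] s by simp
    from pos[OF _ this] s show ?thesis by (auto simp: algebra_simps)
  qed
  \<comment> \<open>A path of length \<open>phi\<close> from 0 would pass first coordinate 1 at time
    \<open>1 / phi\<close>, at a height in \<open>?Y\<close>, hence through a vertex.\<close>
  moreover have "\<not> (p $ 1 = 0 \<and> q $ 1 = phi)"
  proof
    assume *: "p $ 1 = 0 \<and> q $ 1 = phi"
    then have "c = phi" using \<open>q $ 1 = p $ 1 + c\<close> by simp
    have t: "1 / phi \<in> {0<..<1}" using phi_bounds by simp
    then obtain r where r: "r \<in> \<gamma> (1 / phi)" using golden_L_nonempty[OF gl] by fastforce
    have "r $ 1 = 1" "r $ 2 \<in> ?Y" using pos[OF t r] * \<open>c = phi\<close> phi_bounds by auto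
    then have "r \<in> L_vertices" by (auto simp: in_L_vertices_iff)
    then show False using nv[OF t r] by simp
  qed
  moreover have "p $ 1 \<in> {0, 1, phi}" "q $ 1 \<in> {0, 1, phi}"
    using vert by (auto simp: in_L_vertices_iff)
  \<comment> \<open>The positive differences left in \<open>{0, 1, phi}\<close> are 1 and
    \<open>phi - 1\<close>.\<close>
  ultimately show ?thesis using c phi_bounds unfolding inverse_phi by auto
qed

text \<open>The two lower sides, from \<open>pt 0 0\<close> to \<open>pt 1 0\<close> and on to
  \<open>pt phi 0\<close>, realise the only possible lengths.\<close>

lemma saddle_vectors_horizontal: "saddle_vectors (pt 1 0) = {pt 1 0, pt (1 / phi) 0}"
proof -
  have nz: "pt c 0 \<noteq> 0" if "c > 0" for c using that by (simp add: vec_eq_iff forall_2)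
  have scale: "c *\<^sub>R pt a b = pt (c * a) (c * b)" for a b c by (simp add: vec_eq_iff forall_2)
  have "saddle_connection_vector (pt 1 0)"
    by (rule segment_saddle_connection[of _ "pt 0 0"])
      (use nz phi_bounds in \<open>auto simp: in_L_polygon_iff pt_in_L_vertices_iff scale pt_add\<close>)
  moreover have "saddle_connection_vector (pt (1 / phi) 0)"
  proof (rule segment_saddle_connection[of _ "pt 1 0"])
    fix t :: real
    have bound: "t * (phi - 1) \<le> phi - 1 \<longleftrightarrow> t \<le> 1" "t * (phi - 1) < phi - 1 \<longleftrightarrow> t < 1"
      using phi_bounds mult_le_cancel_right1[of t "phi - 1"] mult_less_cancel_right[of t "phi - 1" 1] by auto
    show "pt 1 0 + t *\<^sub>R pt (1 / phi) 0 \<in> L_polygon" if "t \<in> {0..1}"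
    proof -
      have "t * (phi - 1) \<le> phi - 1" "0 \<le> t * (phi - 1)" using that bound phi_bounds by auto
      then have "0 \<le> 1 + t * (phi - 1)" "1 + t * (phi - 1) \<le> phi" by linarith+
      then show ?thesis using phi_bounds by (simp add: inverse_phi scale pt_add in_L_polygon_iff)
    qed
    show "pt 1 0 + t *\<^sub>R pt (1 / phi) 0 \<notin> L_vertices" if "t \<in> {0<..<1}"
    proof -
      have "t * (phi - 1) < phi - 1" "0 < t * (phi - 1)" using that bound phi_bounds by auto
      then show ?thesis unfolding inverse_phi scale pt_add pt_in_L_vertices_iff by linarith
    qed
  qed (use nz phi_bounds in \<open>auto simp: inverse_phi pt_in_L_vertices_iff pt_add\<close>)
  moreover have "w = pt 1 0 \<or> w = pt (1 / phi) 0" if "w \<in> saddle_vectors (pt 1 0)" for w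
    using that horizontal_saddle_connections by (auto simp: saddle_vectors_def same_direction_def scale)
  moreover have "same_direction (pt 1 0) (pt c 0)" if "c > 0" for c
    using that nz by (auto simp: same_direction_def scale)
  ultimately show ?thesis using phi_bounds by (auto simp: saddle_vectors_def)
qed

section \<open>Holonomies of closed trajectories\<close>

definition nat_phi :: "real set" where
  "nat_phi = {real a + real b * phi | a b. True}"

lemma nat_phiI: "x = real a + real b * phi \<Longrightarrow> x \<in> nat_phi"
  by (auto simp: nat_phi_def)

lemma nat_phi_simps [simp]: "0 \<in> nat_phi" "1 \<in> nat_phi" "phi \<in> nat_phi"
  using nat_phiI[of 0 0 0] nat_phiI[of 1 1 0] nat_phiI[of phi 0 1] by auto

lemma nat_phi_add [intro]:
  assumes "x \<in> nat_phi" "y \<in> nat_phi"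
  shows "x + y \<in> nat_phi"
proof -
  obtain a b c d where "x = real a + real b * phi" "y = real c + real d * phi"
    using assms by (auto simp: nat_phi_def)
  then show ?thesis by (intro nat_phiI[of _ "a + c" "b + d"]) (simp add: algebra_simps)
qed

lemma nat_phi_mult_phi [intro]:
  assumes "x \<in> nat_phi"
  shows "phi * x \<in> nat_phi"
proof -
  obtain a b where "x = real a + real b * phi"
    using assms by (auto simp: nat_phi_def)
  then have "phi * x = real a * phi + real b * (phi * phi)" by (simp add: algebra_simps)
  then have "phi * x = real b + real (a + b) * phi"
    unfolding phi_square by (simp add: algebra_simps)
  then show ?thesis by (rule nat_phiI)
qed

text \<open>Nonnegative coefficients keep positive elements away from 0; with integer coefficients
  they would come arbitrarily close to it. This gap makes the descent of itineraries
  terminate.\<close>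

lemma nat_phi_ge_1:
  assumes "x \<in> nat_phi" "x > 0"
  shows "x \<ge> 1"
proof -
  obtain a b where x: "x = real a + real b * phi"
    using assms by (auto simp: nat_phi_def)
  then have "real a \<ge> 1 \<or> real b \<ge> 1" using assms(2) by (cases a; cases b) auto
  moreover have "real b * phi \<ge> real b" using phi_bounds by (simp add: mult_le_cancel_left1)
  ultimately show ?thesis using x by (smt (verit) of_nat_0_le_iff)
qed

text \<open>Moves points of the right and the upper sides to their partners on the left and lower sides.\<close>

definition fold_L :: "real^2 \<Rightarrow> real^2" where
  "fold_L p = pt (if p $ 1 = phi \<or> p $ 1 = 1 \<and> 1 < p $ 2 then 0 else p $ 1)
                 (if p $ 2 = phi \<or> p $ 2 = 1 \<and> 1 < p $ 1 then 0 else p $ 2)"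

text \<open>Makes \<open>fold_L\<close> a function of the point of the surface, away from the
  singularity.\<close>

lemma fold_L_equiv:
  assumes "(p, q) \<in> L_equiv" "p \<notin> L_vertices"
  shows "fold_L p = fold_L q"
proof -
  have *: "fold_L p = fold_L q" if "(p, q) \<in> side_gluing" "p \<notin> L_vertices" for p q
    using that phi_bounds unfolding side_gluing_iff
    by (elim disjE conjE) (auto simp: fold_L_def in_L_vertices_iff pt_eq_iff)
  show ?thesis
    using assms *[of p q] *[of q p] L_equiv_vertices[OF assms(1)] unfolding L_equiv_iff by auto
qed

lemma fold_L_diff: "(p - fold_L p) $ 1 \<in> nat_phi" "(p - fold_L p) $ 2 \<in> nat_phi"
  by (auto simp: fold_L_def)

text \<open>A point that can still move right and up inside the polygon is on no right or upper
  side.\<close>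

lemma fold_L_eq_self:
  assumes "p \<in> L_polygon" "p + s *\<^sub>R w \<in> L_polygon" "s > 0" "w $ 1 > 0" "w $ 2 > 0"
  shows "fold_L p = p"
proof -
  have "s * w $ 1 > 0" "s * w $ 2 > 0" using assms by auto
  then have "p $ 1 \<noteq> phi" "\<not> (p $ 1 = 1 \<and> 1 < p $ 2)" "p $ 2 \<noteq> phi" "\<not> (p $ 2 = 1 \<and> 1 < p $ 1)"
    using assms(1,2) by (auto simp: in_L_polygon_iff)
  then show ?thesis by (auto simp: fold_L_def vec_eq_iff forall_2)
qed

text \<open>Along a trajectory in the open first quadrant, \<open>t *\<^sub>R w - fold_L (\<gamma> t)\<close> is locally constant except
  when a right or an upper side is crossed, where it jumps by \<open>1\<close> or \<open>phi\<close> in one coordinate.\<close>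

lemma holonomy_nat_phi:
  assumes "holonomy u" "u $ 1 > 0" "u $ 2 > 0"
  shows "u $ 1 \<in> nat_phi" "u $ 2 \<in> nat_phi"
proof -
  define D where "D = {v :: real^2. v $ 1 \<in> nat_phi \<and> v $ 2 \<in> nat_phi}"
  have D_add: "a + b \<in> D" if "a \<in> D" "b \<in> D" for a b using that by (auto simp: D_def)
  have D_0: "0 \<in> D" by (simp add: D_def)
  obtain w \<gamma> T where h: "T > 0" "u = T *\<^sub>R w" "straight_path UNIV w \<gamma>"
    and ns: "\<And>t. \<not> singular (\<gamma> t)" and per: "\<And>t. \<gamma> (t + T) = \<gamma> t"
    using assms(1) unfolding holonomy_def by blast
  have w: "w $ 1 > 0" "w $ 2 > 0" using assms(2,3) h(1,2) by (simp_all add: zero_less_mult_iff)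
  have gl: "\<gamma> t \<in> golden_L" for t using straight_path_golden_L[OF h(3)] by simp
  have poly: "p \<in> L_polygon" if "p \<in> \<gamma> t" for p t using golden_L_subset[OF gl that] .
  have fold: "fold_L p = fold_L q" if "p \<in> \<gamma> t" "q \<in> \<gamma> t" for p q t
    using fold_L_equiv[OF golden_L_equiv[OF gl that]] singular_iff[OF gl that(1)] ns[of t] by simp
  define P where "P a b \<longleftrightarrow> (\<forall>p\<in>\<gamma> a. \<forall>q\<in>\<gamma> b. (b - a) *\<^sub>R w - (fold_L q - fold_L p) \<in> D)" for a b
  have "P 0 T"
    using less_imp_le[OF h(1)]
  proof (induction rule: Bolzano)
    case (trans a b c)
    obtain q where q: "q \<in> \<gamma> b" using golden_L_nonempty[OF gl] by blast
    show ?case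
      unfolding P_def
    proof (intro ballI)
      fix p r assume "p \<in> \<gamma> a" "r \<in> \<gamma> c"
      then have "((b - a) *\<^sub>R w - (fold_L q - fold_L p)) + ((c - b) *\<^sub>R w - (fold_L r - fold_L q)) \<in> D"
        using trans(1,2) q unfolding P_def by (intro D_add) blast+
      then show "(c - a) *\<^sub>R w - (fold_L r - fold_L p) \<in> D"
        by (simp add: algebra_simps)
    qed
  next
    case (local x)
    obtain e p where p: "e > 0" "p \<in> \<gamma> x" "\<forall>s\<in>{0..e}. p + s *\<^sub>R w \<in> \<gamma> (x + s)"
      using h(3) unfolding straight_path_def by (metis UNIV_I)
    obtain d q where q: "d > 0" "q \<in> \<gamma> x" "\<forall>s\<in>{0..d}. q - s *\<^sub>R w \<in> \<gamma> (x - s)"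
      using h(3) unfolding straight_path_def by (metis UNIV_I)
    have "P a b" if ab: "a \<le> x" "x \<le> b" "b - a < min d e" for a b
      unfolding P_def
    proof (intro ballI)
      fix p' q' assume p': "p' \<in> \<gamma> a" and q': "q' \<in> \<gamma> b"
      \<comment> \<open>Before time \<open>e\<close> on the germ there is room left to move, so its
        points are their own folds.\<close>
      have fwd: "fold_L (p + s *\<^sub>R w) = p + s *\<^sub>R w" if "0 \<le> s" "s < e" for s
      proof (rule fold_L_eq_self[of _ "e - s"])
        show "p + s *\<^sub>R w \<in> L_polygon" using p(3) that by (intro poly[of _ "x + s"]) auto
        have eq: "p + s *\<^sub>R w + (e - s) *\<^sub>R w = p + e *\<^sub>R w" by (simp add: algebra_simps)
        show "p + s *\<^sub>R w + (e - s) *\<^sub>R w \<in> L_polygon"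
          unfolding eq using p(1,3) by (intro poly[of _ "x + e"]) simp
      qed (use that w in auto)
      have "p + (b - x) *\<^sub>R w \<in> \<gamma> b" using p(3)[rule_format, of "b - x"] ab by simp
      then have q'_eq: "fold_L q' = p + (b - x) *\<^sub>R w" using fold[OF q'] fwd[of "b - x"] ab by simp
      have p_eq: "fold_L q = p" using fold[OF q(2) p(2)] fwd[of 0] p(1) by simp
      have qa: "q - (x - a) *\<^sub>R w \<in> \<gamma> a" using q(3)[rule_format, of "x - a"] ab by simp
      show "(b - a) *\<^sub>R w - (fold_L q' - fold_L p') \<in> D"
      proof (cases "a = x")
        case True
        then have "fold_L p' = p" using fold[OF p'] q(2) p_eq by simp
        then show ?thesis using q'_eq True D_0 by simp
      next
        case False
        have "fold_L (q - (x - a) *\<^sub>R w) = q - (x - a) *\<^sub>R w"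
          by (rule fold_L_eq_self[of _ "x - a" w]) (use False ab poly[OF qa] poly[OF q(2)] w in auto)
        then have "fold_L p' = q - (x - a) *\<^sub>R w" using fold[OF p' qa] by simp
        \<comment> \<open>Folding does nothing just before and just after \<open>x\<close>, so only
          the jump \<open>q - fold_L q\<close> at \<open>x\<close> remains.\<close>
        then have "(b - a) *\<^sub>R w - (fold_L q' - fold_L p') = q - fold_L q"
          unfolding q'_eq p_eq by (simp add: algebra_simps)
        then show ?thesis using fold_L_diff[of q] unfolding D_def by simp
      qed
    qed
    then show ?case using p(1) q(1) by (intro exI[of _ "min d e"]) auto
  qed
  moreover obtain p where "p \<in> \<gamma> 0" using golden_L_nonempty[OF gl] by blast
  moreover from this have "p \<in> \<gamma> T" using per[of 0] by simp
  \<comment> \<open>By periodicity one point represents both ends, so the two folds cancel and the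
    whole displacement lies in \<open>D\<close>.\<close>
  ultimately have "T *\<^sub>R w \<in> D" unfolding P_def by force
  then show "u $ 1 \<in> nat_phi" "u $ 2 \<in> nat_phi" unfolding h(2) D_def by auto
qed

section \<open>Itineraries\<close>

lemma sector_subset: "k < 4 \<Longrightarrow> v \<in> Sigma_sector \<Longrightarrow> sigma k *v v \<in> Sigma_sector"
  using phi_bounds by (auto simp: sigma_eq Sigma_sector_def add_pos_nonneg add_nonneg_nonneg)

lemma sector_index_sigma:
  assumes "k < 4" "v \<in> Sigma_sector"
  shows "sector_index (sigma k *v v) = k"
proof -
  have "k < 4 \<and> sigma k *v v \<in> sector k" using assms by (auto simp: sector_def)
  then show ?thesis
    unfolding sector_index_def by (rule the1_equality[OF sector_index_ex1[OF sector_subset[OF assms]]])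
qed

lemma sector_decompose:
  assumes "v \<in> Sigma_sector"
  obtains k u where "k < 4" "u \<in> Sigma_sector" "v = sigma k *v u"
  using sector_index_ex1[OF assms] by (auto simp: sector_def)

lemma sector_orbit_shift:
  "sector_orbit v (Suc i) = sector_orbit (matrix_inv (sigma (sector_index v)) *v v) i"
  by (induction i) simp_all

lemma sigma_prod_simps:
  "sigma_prod [] *v v = v"
  "sigma_prod (k # ks) *v v = sigma k *v (sigma_prod ks *v v)"
  by (simp_all add: sigma_prod_def matrix_vector_mul_assoc)

lemma sigma_prod_sector: "set ks \<subseteq> {..<4} \<Longrightarrow> v \<in> Sigma_sector \<Longrightarrow> sigma_prod ks *v v \<in> Sigma_sector"
  by (induction ks) (simp_all add: sigma_prod_simps sector_subset)

text \<open>\<open>sigma k\<close> maps \<open>Sigma_sector\<close> into sector \<open>k\<close>, so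
  one step of the itinerary strips the first factor. The horizontal vector left at the end is fixed
  by \<open>sigma 0\<close>, which yields the zeros.\<close>

lemma sigma_prod_itinerary:
  assumes "set ks \<subseteq> {..<4}" "l > 0"
  shows "sector_itinerary (l *\<^sub>R (sigma_prod ks *v pt 1 0)) i = (if i < length ks then ks ! i else 0)"
  using assms(1)
proof (induction ks arbitrary: i)
  case Nil
  have l: "l *\<^sub>R pt 1 0 \<in> Sigma_sector" using assms(2) by (simp add: Sigma_sector_def)
  have fix0: "sigma 0 *v (l *\<^sub>R pt 1 0) = l *\<^sub>R pt 1 0" by (simp add: sigma_eq vec_eq_iff forall_2)
  have ix: "sector_index (l *\<^sub>R pt 1 0) = 0" using sector_index_sigma[of 0, OF _ l] fix0 by simp
  have "sector_orbit (l *\<^sub>R pt 1 0) i = l *\<^sub>R pt 1 0"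
    using matrix_inv_sigma(1)[of 0 "l *\<^sub>R pt 1 0"] by (induction i) (simp_all add: ix fix0)
  then show ?case by (simp add: sector_itinerary_def sigma_prod_simps ix)
next
  case (Cons k ks)
  let ?u = "l *\<^sub>R (sigma_prod ks *v pt 1 0)"
  have k: "k < 4" using Cons.prems by simp
  have u: "?u \<in> Sigma_sector"
    using sigma_prod_sector[of ks "pt 1 0"] Cons.prems assms(2) by (simp add: Sigma_sector_def)
  have v: "l *\<^sub>R (sigma_prod (k # ks) *v pt 1 0) = sigma k *v ?u"
    by (simp add: sigma_prod_simps sigma_scaleR)
  have shift: "sector_itinerary (sigma k *v ?u) (Suc j) = sector_itinerary ?u j" for j
    unfolding sector_itinerary_def sector_orbit_shift sector_index_sigma[OF k u] matrix_inv_sigma(1)[OF k] ..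
  show ?case
  proof (cases i)
    case 0
    then show ?thesis unfolding v using sector_index_sigma[OF k u] by (simp add: sector_itinerary_def)
  next
    case (Suc j)
    then show ?thesis unfolding v using Cons shift[of j] by simp
  qed
qed

lemma sigma_prod_truncated_itinerary:
  assumes "admissible_seq ks" "l > 0" "v = l *\<^sub>R (sigma_prod ks *v pt 1 0)"
  shows "truncated_itinerary v ks"
  using assms sigma_prod_itinerary by (simp add: truncated_itinerary_def admissible_seq_def)

lemma truncated_itinerary_unique:
  assumes "truncated_itinerary v ks" "truncated_itinerary v ks'"
  shows "ks = ks'"
proof -
  have nth: "(if i < length ks then ks ! i else 0) = (if i < length ks' then ks' ! i else 0)" for i
    using assms unfolding truncated_itinerary_def by metis
  \<comment> \<open>At the last index of \<open>as\<close> the entry is nonzero, so this index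
    cannot lie in the zero padding of \<open>bs\<close>.\<close>
  have le: "length as \<le> length bs"
    if "as = [] \<or> last as \<noteq> 0" "(if i < length as then as ! i else 0) = (if i < length bs then bs ! i else 0)"
      "i = length as - 1" for as bs :: "nat list" and i
    using that by (cases "as = []") (auto simp: last_conv_nth split: if_splits)
  have "length ks \<le> length ks'" "length ks' \<le> length ks"
    using assms le[OF _ nth refl] le[OF _ nth[symmetric] refl] by (auto simp: truncated_itinerary_def)
  then have "length ks = length ks'" by simp
  then show ?thesis
  proof (rule nth_equalityI)
    show "ks ! i = ks' ! i" if "i < length ks" for i
      using nth[of i] that \<open>length ks = length ks'\<close> by simp
  qed
qed

text \<open>Descent on the integer part of the coordinate sum, which goes on until the vector is
  horizontal.\<close>

lemma holonomy_itinerary: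
  assumes "holonomy u" "u \<in> Sigma_sector"
  shows "\<exists>ks l. admissible_seq ks \<and> l > 0 \<and> u = l *\<^sub>R (sigma_prod ks *v pt 1 0)"
  using assms
proof (induction "nat \<lfloor>u $ 1 + u $ 2\<rfloor>" arbitrary: u rule: less_induct)
  case less
  show ?case
  proof (cases "u $ 2 = 0")
    case True
    then have "u = (u $ 1) *\<^sub>R (sigma_prod [] *v pt 1 0)"
      by (simp add: sigma_prod_simps vec_eq_iff forall_2)
    then show ?thesis using less.prems(2)
      by (intro exI[of _ "[]"] exI[of _ "u $ 1"]) (simp add: admissible_seq_def Sigma_sector_def)
  next
    case False
    then have pos: "u $ 1 > 0" "u $ 2 > 0" using less.prems(2) by (auto simp: Sigma_sector_def)
    obtain k z where k: "k < 4" "z \<in> Sigma_sector" "u = sigma k *v z"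
      using sector_decompose[OF less.prems(2)] .
    have "holonomy z"
      using holonomy_veech[OF veech_sigma(2)[OF k(1)] matrix_vector_mul_linear less.prems(1)]
        matrix_inv_sigma(1)[OF k(1)] k(3) by simp
    \<comment> \<open>The last clause ensures that \<open>k # ks\<close> still ends in a nonzero
      entry.\<close>
    have "\<exists>ks l. admissible_seq ks \<and> l > 0 \<and> z = l *\<^sub>R (sigma_prod ks *v pt 1 0) \<and> (ks = [] \<longrightarrow> k \<noteq> 0)"
    proof (cases "z $ 2 = 0")
      case True
      then have "k \<noteq> 0" using pos(2) unfolding k(3) by (cases "k = 0") (simp_all add: sigma_eq)
      moreover have "z = (z $ 1) *\<^sub>R (sigma_prod [] *v pt 1 0)"
        using True by (simp add: sigma_prod_simps vec_eq_iff forall_2)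
      ultimately show ?thesis using k(2)
        by (intro exI[of _ "[]"] exI[of _ "z $ 1"]) (simp add: admissible_seq_def Sigma_sector_def)
    next
      case False
      then have z: "z $ 1 > 0" "z $ 2 > 0" using k(2) by (auto simp: Sigma_sector_def)
      then have z1: "z $ 1 \<ge> 1" "z $ 2 \<ge> 1"
        using holonomy_nat_phi[OF \<open>holonomy z\<close>] nat_phi_ge_1 by auto
      then have z2: "phi * z $ 1 \<ge> z $ 1" "phi * z $ 2 \<ge> z $ 2" using phi_bounds by simp_all
      \<comment> \<open>Each matrix adds at least \<open>phi * z $ 1\<close> or
        \<open>phi * z $ 2\<close> to the sum, and both are at least 1.\<close>
      have "u $ 1 + u $ 2 \<ge> z $ 1 + z $ 2 + 1"
        using k(1) unfolding k(3)
        by (cases rule: less_4_cases) (simp_all add: sigma_eq, (use z1 z2 in linarith)+)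
      then have "nat \<lfloor>z $ 1 + z $ 2\<rfloor> < nat \<lfloor>u $ 1 + u $ 2\<rfloor>"
        using z by linarith
      from less.hyps[OF this \<open>holonomy z\<close> k(2)] obtain ks l where
        ks: "admissible_seq ks" "l > 0" "z = l *\<^sub>R (sigma_prod ks *v pt 1 0)" by blast
      moreover have "ks \<noteq> []" using ks(3) z(2) by (auto simp: sigma_prod_simps)
      ultimately show ?thesis by blast
    qed
    then obtain ks l where "admissible_seq ks" "l > 0" "z = l *\<^sub>R (sigma_prod ks *v pt 1 0)" "ks = [] \<longrightarrow> k \<noteq> 0"
      by blast
    then show ?thesis using k(1,3)
      by (intro exI[of _ "k # ks"] exI[of _ l]) (auto simp: admissible_seq_def sigma_prod_simps sigma_scaleR)
  qed
qed

section \<open>The long saddle connection and the conclusion\<close>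

text \<open>All entries of the matrices are 0, 1 or \<open>phi\<close>, and \<open>nat_phi\<close>
  is closed under addition and multiplication by \<open>phi\<close>.\<close>

lemma sigma_prod_nat_phi:
  assumes "set ks \<subseteq> {..<4}"
  shows "(sigma_prod ks *v pt 1 0) $ 1 \<in> nat_phi \<and> (sigma_prod ks *v pt 1 0) $ 2 \<in> nat_phi"
  using assms by (induction ks) (auto simp: sigma_prod_simps sigma_eq)

lemma sigma_prod_saddle_vectors:
  assumes "set ks \<subseteq> {..<4}"
  shows "saddle_vectors (sigma_prod ks *v pt 1 0)
    = {sigma_prod ks *v pt 1 0, (1 / phi) *\<^sub>R (sigma_prod ks *v pt 1 0)}"
  using assms
proof (induction ks)
  case Nil
  have "pt (1 / phi) 0 = (1 / phi) *\<^sub>R pt 1 0" by (simp add: vec_eq_iff forall_2)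
  then show ?case using saddle_vectors_horizontal by (simp add: sigma_prod_simps)
next
  case (Cons k ks)
  then show ?case by (simp add: sigma_prod_simps saddle_vectors_sigma sigma_scaleR)
qed

lemma long_saddle_connection_vectorI:
  assumes sv: "saddle_vectors v = {w, (1 / phi) *\<^sub>R w}"
  shows "long_saddle_connection_vector v w"
proof -
  have "saddle_lengths v = norm ` saddle_vectors v"
    by (auto simp: saddle_lengths_def saddle_vectors_def)
  then have "saddle_lengths v = {norm w / phi, norm w}"
    using phi_bounds by (auto simp: sv)
  moreover have w: "saddle_connection_vector w" "same_direction v w"
    using sv by (auto simp: saddle_vectors_def)
  moreover have "norm w / phi < norm w"
    using w phi_bounds by (simp add: saddle_connection_vector_def divide_less_eq)
  ultimately show ?thesis unfolding long_saddle_connection_vector_def by blast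
qed

theorem theorem2p23:
  fixes v :: "real^2"
  assumes "v \<in> Sigma_sector"
    and "periodic_direction v"
  shows "\<exists>ks. truncated_itinerary v ks
           \<and> admissible_seq ks
           \<and> (\<exists>l>0. v = l *\<^sub>R (sigma_prod ks *v vector [1, 0]))
           \<and> (\<forall>ks'. admissible_seq ks' \<and> (\<exists>l>0. v = l *\<^sub>R (sigma_prod ks' *v vector [1, 0]))
                    \<longrightarrow> ks' = ks)
           \<and> long_saddle_connection_vector v (sigma_prod ks *v vector [1, 0])
           \<and> (\<exists>a b c d :: nat. sigma_prod ks *v vector [1, 0]
                  = vector [real a + real b * phi, real c + real d * phi])"
proof -
  obtain c where c: "c > 0" "holonomy (c *\<^sub>R v)" using periodic_direction_holonomy[OF assms(2)] by blast
  have "c *\<^sub>R v \<in> Sigma_sector" using assms(1) c(1) by (simp add: Sigma_sector_def)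
  then obtain ks m where ks: "admissible_seq ks" and m: "m > 0" "c *\<^sub>R v = m *\<^sub>R (sigma_prod ks *v pt 1 0)"
    using holonomy_itinerary[OF c(2)] by blast
  define l where "l = m / c"
  have "v = (1 / c) *\<^sub>R (c *\<^sub>R v)" using c(1) by simp
  then have l: "l > 0" "v = l *\<^sub>R (sigma_prod ks *v pt 1 0)"
    using c(1) m by (simp_all add: l_def)
  have set_ks: "set ks \<subseteq> {..<4}" using ks by (simp add: admissible_seq_def)
  have itin: "truncated_itinerary v ks" using sigma_prod_truncated_itinerary[OF ks l] .
  \<comment> \<open>Any such representation already determines the itinerary, so two of them have
    the same sequence.\<close>
  have unique: "ks' = ks" if "admissible_seq ks'" "\<exists>l>0. v = l *\<^sub>R (sigma_prod ks' *v pt 1 0)" for ks'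
    using that sigma_prod_truncated_itinerary itin truncated_itinerary_unique by blast
  have long: "long_saddle_connection_vector v (sigma_prod ks *v pt 1 0)"
    using sigma_prod_saddle_vectors[OF set_ks] saddle_vectors_scaleR[OF l(1)] l(2)
    by (intro long_saddle_connection_vectorI) simp
  have "\<exists>a b c d :: nat. sigma_prod ks *v pt 1 0 = pt (real a + real b * phi) (real c + real d * phi)"
    using sigma_prod_nat_phi[OF set_ks] by (auto simp: nat_phi_def vec_eq_iff forall_2)
  then show ?thesis using itin ks l unique long by blast
qed

end
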